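(* Let $\mathbb K$ be an algebraically closed field of characteristic $3$ and let $\mathfrak g=\mathfrak{sl}(3)$ over $\mathbb K$. For $i\ge0$ and $k\in\mathbb Z$ let $H^i_k(\mathfrak g)$ be the degree-$k$ component (with respect to the principal grading) of the cohomology $H^i(\mathfrak g)$ with coefficients in the trivial module $\mathbb K$. Then: (a) $\dim H^0_0=1$, $\dim H^2_0=2$, $\dim H^3_0=3$, $\dim H^5_0=3$, $\dim H^6_0=2$, $\dim H^8_0=1$, and $H^i_0=0$ for all other $i$; (b) for $k=\pm3$, $\dim H^2_k=\dim H^3_k=\dim H^5_k=\dim H^6_k=2$, and $H^i_k=0$ for all other $i$; (c) $H^i_k=0$ for all $i$ if $k\notin\{0,\pm3\}$.
   Context: The principal grading of $\mathfrak{sl}(3)$ is the $\mathbb Z$-grading in which the positive Chevalley generators $x_1=E_{12},x_2=E_{23}$ have degree $1$, the negative ones $y_1=E_{21},y_2=E_{32}$ have degree $-1$ and the diagonal matrices have degree $0$. It induces a $\mathbb Z$-grading of the Chevalley--Eilenberg cochain complex $\Lambda^{\bullet}(\mathfrak g^* )$ (where an element of $\mathfrak g^*$ dual to a degree-$d$ element has degree $-d$) and of its cohomology. *)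

theory Defs
  imports
    "HOL-Computational_Algebra.Polynomial"
    "HOL-Algebra.AbelCoset"
    "Jordan_Normal_Form.VS_Connect"
begin

section \<open>Quotients and dimensions of vector spaces\<close>

definition quot_module :: "('a, 'b, 'c) module_scheme \<Rightarrow> 'b set \<Rightarrow> ('a, 'b set) module" where
  "quot_module M N =
     \<lparr>carrier = a_rcosets\<^bsub>M\<^esub> N, mult = undefined, one = undefined,
      zero = N, add = (<+>\<^bsub>M\<^esub>),
      smult = (\<lambda>c X. \<Union>x\<in>X. N +>\<^bsub>M\<^esub> (c \<odot>\<^bsub>M\<^esub> x))\<rparr>"

text \<open>\<^const>\<open>vectorspace.dim\<close> is a least cardinality of finite generating sets, so it is
  meaningful only together with \<^const>\<open>vectorspace.fin_dim\<close>.\<close>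

definition has_dim :: "('a::field, 'b, 'c) module_scheme \<Rightarrow> nat \<Rightarrow> bool" where
  "has_dim V n \<longleftrightarrow>
     vectorspace class_ring V \<and> vectorspace.fin_dim class_ring V \<and>
     vectorspace.dim class_ring V = n"


section \<open>The special linear Lie algebra and its principal grading\<close>

definition sl :: "nat \<Rightarrow> 'a::field mat set" where
  "sl n = {A \<in> carrier_mat n n. (\<Sum>i<n. A $$ (i, i)) = 0}"

definition lie_bracket :: "'a::field mat \<Rightarrow> 'a mat \<Rightarrow> 'a mat" where
  "lie_bracket A B = A * B - B * A"

text \<open>The matrix unit in position \<open>(i, j)\<close> has degree \<open>j - i\<close>; this is the only Lie algebra
  grading for which the elements just above (below) the diagonal have degree \<open>1\<close>
  (degree \<open>-1\<close>) and the diagonal ones degree \<open>0\<close>.\<close>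

definition principal_grading :: "nat \<Rightarrow> int \<Rightarrow> 'a::field mat set" where
  "principal_grading n d =
     {A \<in> sl n. \<forall>i<n. \<forall>j<n. A $$ (i, j) \<noteq> 0 \<longrightarrow> int j - int i = d}"

definition matrix_unit :: "nat \<Rightarrow> nat \<Rightarrow> nat \<Rightarrow> 'a::field mat" where
  "matrix_unit n i j = mat n n (\<lambda>(k, l). if k = i \<and> l = j then 1 else 0)"

lemma lie_bracket_in_sl:
  assumes "A \<in> sl n" "B \<in> sl n"
  shows "lie_bracket A B \<in> sl n"
proof -
  have A: "A \<in> carrier_mat n n" and B: "B \<in> carrier_mat n n"
    using assms by (auto simp: sl_def)
  have "(\<Sum>i<n. (A * B) $$ (i, i)) = (\<Sum>i<n. \<Sum>j<n. A $$ (i, j) * B $$ (j, i))"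
    using A B by (intro sum.cong) (auto simp: scalar_prod_def atLeast0LessThan)
  also have "\<dots> = (\<Sum>j<n. \<Sum>i<n. B $$ (j, i) * A $$ (i, j))"
    by (subst sum.swap) (simp add: mult.commute)
  also have "\<dots> = (\<Sum>i<n. (B * A) $$ (i, i))"
    using A B by (intro sum.cong) (auto simp: scalar_prod_def atLeast0LessThan)
  finally show ?thesis
    using A B by (auto simp: sl_def lie_bracket_def sum_subtractf)
qed

lemma lie_bracket_principal_grading:
  assumes A: "A \<in> principal_grading n d" and B: "B \<in> principal_grading n e"
  shows "lie_bracket A B \<in> principal_grading n (d + e)"
proof -
  have nz: "int j - int i = d + e"
    if C: "C \<in> principal_grading n d" and D: "D \<in> principal_grading n e"
      and ij: "i < n" "j < n" and ne: "(C * D) $$ (i, j) \<noteq> 0" for C D :: "'a mat" and d e i j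
  proof -
    have "(C * D) $$ (i, j) = (\<Sum>k<n. C $$ (i, k) * D $$ (k, j))"
      using C D ij by (auto simp: principal_grading_def sl_def scalar_prod_def atLeast0LessThan)
    with ne obtain k where "k < n" "C $$ (i, k) * D $$ (k, j) \<noteq> 0"
      by (metis (no_types, lifting) lessThan_iff sum.neutral)
    then have "int k - int i = d" "int j - int k = e"
      using C D ij by (auto simp: principal_grading_def)
    then show ?thesis by simp
  qed
  have cA: "A \<in> carrier_mat n n" and cB: "B \<in> carrier_mat n n"
    and sA: "A \<in> sl n" and sB: "B \<in> sl n"
    using A B by (auto simp: principal_grading_def sl_def)
  have "int j - int i = d + e"
    if "i < n" "j < n" "lie_bracket A B $$ (i, j) \<noteq> 0" for i j
  proof -
    have "(A * B) $$ (i, j) \<noteq> 0 \<or> (B * A) $$ (i, j) \<noteq> 0"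
      using that cA cB by (auto simp: lie_bracket_def)
    then show ?thesis using nz[OF A B that(1,2)] nz[OF B A that(1,2)] by auto
  qed
  then show ?thesis using lie_bracket_in_sl[OF sA sB] by (simp add: principal_grading_def)
qed

lemma matrix_unit_principal_grading:
  assumes "i < n" "j < n" "i \<noteq> j"
  shows "matrix_unit n i j \<in> principal_grading n (int j - int i)"
  using assms by (auto simp: principal_grading_def sl_def matrix_unit_def intro!: sum.neutral
      split: if_splits)

lemma diagonal_principal_grading:
  assumes "A \<in> sl n" "\<And>i j. i < n \<Longrightarrow> j < n \<Longrightarrow> i \<noteq> j \<Longrightarrow> A $$ (i, j) = 0"
  shows "A \<in> principal_grading n 0"
  using assms by (auto simp: principal_grading_def)


section \<open>Chevalley--Eilenberg cohomology with trivial coefficients\<close>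

text \<open>In the following \<open>g\<close> is the carrier of a Lie algebra of matrices. The space of
  \<open>i\<close>-cochains, the exterior power \<open>\<Lambda>\<^sup>i(g\<^sup>*)\<close>, is realised as the space of alternating
  \<open>i\<close>-linear forms on \<open>g\<close>; a form takes the list of its arguments, and it is set to \<open>0\<close>
  outside its domain so that equality of forms is equality of functions. Since the
  characteristic is arbitrary, alternating means vanishing on repeated arguments.\<close>

definition arg_lists :: "'a mat set \<Rightarrow> nat \<Rightarrow> 'a mat list set" where
  "arg_lists g i = {xs. length xs = i \<and> set xs \<subseteq> g}"

definition cochains :: "'a::field mat set \<Rightarrow> nat \<Rightarrow> ('a mat list \<Rightarrow> 'a) set" where
  "cochains g i = {f.
     (\<forall>xs. xs \<notin> arg_lists g i \<longrightarrow> f xs = 0) \<and>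
     (\<forall>xs\<in>arg_lists g i. \<forall>p<i. \<forall>x\<in>g. \<forall>y\<in>g.
        f (xs[p := x + y]) = f (xs[p := x]) + f (xs[p := y])) \<and>
     (\<forall>xs\<in>arg_lists g i. \<forall>p<i. \<forall>x\<in>g. \<forall>c. f (xs[p := c \<cdot>\<^sub>m x]) = c * f (xs[p := x])) \<and>
     (\<forall>xs\<in>arg_lists g i. \<forall>p q. p < q \<and> q < i \<and> xs ! p = xs ! q \<longrightarrow> f xs = 0)}"

text \<open>The list \<^term>\<open>nths xs (- {p, q})\<close> is \<open>xs\<close> with the entries at \<open>p\<close> and \<open>q\<close> omitted.
  Positions start at \<open>0\<close>, which does not affect the parity of \<open>p + q\<close>.\<close>

definition ce_diff :: "'a::field mat set \<Rightarrow> nat \<Rightarrow> ('a mat list \<Rightarrow> 'a) \<Rightarrow> 'a mat list \<Rightarrow> 'a" where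
  "ce_diff g i f = (\<lambda>xs. if xs \<in> arg_lists g (Suc i)
     then \<Sum>q<Suc i. \<Sum>p<q.
       (- 1) ^ (p + q) * f (lie_bracket (xs ! p) (xs ! q) # nths xs (- {p, q}))
     else 0)"

definition cocycles :: "'a::field mat set \<Rightarrow> nat \<Rightarrow> ('a mat list \<Rightarrow> 'a) set" where
  "cocycles g i = {f \<in> cochains g i. ce_diff g i f = (\<lambda>_. 0)}"

definition coboundaries :: "'a::field mat set \<Rightarrow> nat \<Rightarrow> ('a mat list \<Rightarrow> 'a) set" where
  "coboundaries g i = (case i of 0 \<Rightarrow> {\<lambda>_. 0} | Suc m \<Rightarrow> ce_diff g m ` cochains g m)"

definition cocycle_module :: "'a::field mat set \<Rightarrow> nat \<Rightarrow> ('a, 'a mat list \<Rightarrow> 'a) module" where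
  "cocycle_module g i =
     \<lparr>carrier = cocycles g i, mult = undefined, one = undefined,
      zero = (\<lambda>_. 0), add = (\<lambda>f h xs. f xs + h xs), smult = (\<lambda>c f xs. c * f xs)\<rparr>"

definition cohomology :: "'a::field mat set \<Rightarrow> nat \<Rightarrow> ('a, ('a mat list \<Rightarrow> 'a) set) module" where
  "cohomology g i = quot_module (cocycle_module g i) (coboundaries g i)"

text \<open>For a grading \<open>gr\<close> of \<open>g\<close>, the dual of \<open>gr d\<close> sits in degree \<open>-d\<close>. So a form has degree
  \<open>k\<close> iff it vanishes on homogeneous arguments whose degrees do not add up to \<open>-k\<close>.\<close>

definition graded_cochains ::
    "'a::field mat set \<Rightarrow> (int \<Rightarrow> 'a mat set) \<Rightarrow> nat \<Rightarrow> int \<Rightarrow> ('a mat list \<Rightarrow> 'a) set" where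
  "graded_cochains g gr i k = {f \<in> cochains g i.
     \<forall>xs ds. length xs = i \<and> length ds = i \<and> (\<forall>p<i. xs ! p \<in> gr (ds ! p)) \<and> sum_list ds \<noteq> - k
       \<longrightarrow> f xs = 0}"

text \<open>The degree \<open>k\<close> component of the cohomology is the subspace of those classes that are
  represented by a cocycle of degree \<open>k\<close>.\<close>

definition graded_cohomology ::
    "'a::field mat set \<Rightarrow> (int \<Rightarrow> 'a mat set) \<Rightarrow> nat \<Rightarrow> int
      \<Rightarrow> ('a, ('a mat list \<Rightarrow> 'a) set) module" where
  "graded_cohomology g gr i k = (cohomology g i)
     \<lparr>carrier := (\<lambda>z. coboundaries g i +>\<^bsub>cocycle_module g i\<^esub> z) `
        (cocycles g i \<inter> graded_cochains g gr i k)\<rparr>"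

end

theory Submission
  imports Defs "HOL-Library.Sublist"
begin

text \<open>Two mechanisms determine the cohomology.

Let \<open>h = E\<^sub>1\<^sub>1 - E\<^sub>2\<^sub>2\<close>. Both simple roots take the value \<open>-1\<close> on \<open>h\<close> modulo \<open>3\<close>, so
\<open>[h, x] = -d x\<close> for every \<open>x\<close> of principal degree \<open>d\<close>, and the Lie derivative along \<open>h\<close> multiplies
a form of degree \<open>k\<close> by \<open>-k\<close>. By Cartan's formula it is homotopic to zero, the homotopy being
contraction with \<open>h\<close>; hence nothing survives in a degree that is not divisible by \<open>3\<close>
(\<open>trivial_by_weight\<close>). Since distinct basis vectors have total degree between \<open>-4\<close> and \<open>4\<close>, only the
degrees \<open>0\<close> and \<open>\<plusminus>3\<close> remain. The forms of these degrees, over all exterior powers, make up spaces of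
dimension \<open>56\<close>, \<open>16\<close> and \<open>16\<close>.

There the complex is contracted explicitly. Work with the chain complex \<open>\<Lambda>(g)\<close> dual to the forms, in
the basis of increasing monomials in eight basis vectors, with integer coefficients modulo \<open>3\<close>. The
table \<open>homotopy_table\<close> is a map \<open>H\<close> raising the exterior power by one, and \<open>class_table\<close> lists cycles
\<open>\<phi>\<^sub>j\<close> and cocycles \<open>z\<^sub>j\<close> that are dual to each other, such that modulo \<open>3\<close>
\<open>S = H(\<partial>S) + \<partial>(H S) + \<Sum>\<^sub>j z\<^sub>j(S) \<phi>\<^sub>j\<close> for all monomials \<open>S\<close> of the relevant degrees. Evaluating a
cocycle \<open>f\<close> on this identity gives \<open>f = d(f \<circ> H) + \<Sum>\<^sub>j f(\<phi>\<^sub>j) z\<^sub>j\<close>, so the classes of the \<open>z\<^sub>j\<close>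
generate; they are independent because coboundaries vanish on the cycles \<open>\<phi>\<^sub>j\<close>
(\<open>has_dim_by_homotopy\<close>). The dimensions are the numbers of entries of \<open>class_table\<close>.

The link between the two pictures is that a form is the same thing as an arbitrary function on
increasing monomials (\<open>cochain_eqI\<close>, \<open>cochain_with_values_basis\<close>), and that the differential is the
transpose of the boundary operator (\<open>ce_diff_basis\<close>). Both come from a recursive description of
alternating forms by contraction with the first argument (\<open>cochains_Suc_iff\<close>), in which Cartan's
formula (\<open>contract_ce_diff\<close>) becomes the recursion equation for the differential.\<close>

section \<open>Dimension of a graded piece of the cohomology\<close>

text \<open>A structure that receives a linear bijection from coordinate space inherits the vector space axioms
along with the dimension.\<close>

lemma has_dim_if_iso:
  fixes M :: "('a::field, 'b, 'c) module_scheme"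
  assumes bij: "bij_betw \<psi> (carrier_vec n) (carrier M)"
    and zero: "\<psi> (0\<^sub>v n) = \<zero>\<^bsub>M\<^esub>"
    and add: "\<And>u v. u \<in> carrier_vec n \<Longrightarrow> v \<in> carrier_vec n \<Longrightarrow> \<psi> (u + v) = \<psi> u \<oplus>\<^bsub>M\<^esub> \<psi> v"
    and smult: "\<And>c v. v \<in> carrier_vec n \<Longrightarrow> \<psi> (c \<cdot>\<^sub>v v) = c \<odot>\<^bsub>M\<^esub> \<psi> v"
  shows "has_dim M n"
proof -
  have im: "\<psi> v \<in> carrier M" if "v \<in> carrier_vec n" for v
    using bij that by (auto simp: bij_betw_def)
  have ex: "\<exists>v\<in>carrier_vec n. x = \<psi> v" if "x \<in> carrier M" for x
    using bij that by (auto simp: bij_betw_def)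
  have M_abelian: "abelian_group M"
  proof (rule abelian_groupI)
    show "\<zero>\<^bsub>M\<^esub> \<in> carrier M" using im[of "0\<^sub>v n"] zero by simp
  next
    fix x y assume "x \<in> carrier M" "y \<in> carrier M"
    then obtain u v where uv: "u \<in> carrier_vec n" "v \<in> carrier_vec n" "x = \<psi> u" "y = \<psi> v"
      using ex by meson
    show "x \<oplus>\<^bsub>M\<^esub> y \<in> carrier M"
      using uv im[of "u + v"] add by simp
    show "x \<oplus>\<^bsub>M\<^esub> y = y \<oplus>\<^bsub>M\<^esub> x"
      using uv add[of u v] add[of v u] comm_add_vec[of u n v] by simp
    fix z assume "z \<in> carrier M"
    then obtain w where w: "w \<in> carrier_vec n" "z = \<psi> w" using ex by meson
    show "x \<oplus>\<^bsub>M\<^esub> y \<oplus>\<^bsub>M\<^esub> z = x \<oplus>\<^bsub>M\<^esub> (y \<oplus>\<^bsub>M\<^esub> z)"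
      using uv w add[of "u + v" w] add[of u "v + w"] add[of u v] add[of v w]
        assoc_add_vec[of u n v w] by simp
  next
    fix x assume "x \<in> carrier M"
    then obtain u where u: "u \<in> carrier_vec n" "x = \<psi> u" using ex by meson
    show "\<zero>\<^bsub>M\<^esub> \<oplus>\<^bsub>M\<^esub> x = x"
      using u add[of "0\<^sub>v n" u] zero by simp
    have "- u + u = 0\<^sub>v n" using u by (simp add: uminus_l_inv_vec)
    then have "\<psi> (- u) \<oplus>\<^bsub>M\<^esub> x = \<zero>\<^bsub>M\<^esub>"
      using u add[of "- u" u] zero by simp
    then show "\<exists>y\<in>carrier M. y \<oplus>\<^bsub>M\<^esub> x = \<zero>\<^bsub>M\<^esub>"
      using im[of "- u"] u by auto
  qed
  have fld: "field (class_ring :: 'a ring)" by (rule class_field)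
  then have cr: "cring (class_ring :: 'a ring)"
    unfolding field_def domain_def by simp
  have M_module: "module class_ring M"
  proof (rule moduleI[OF cr M_abelian])
    fix a x assume "a \<in> carrier (class_ring :: 'a ring)" "x \<in> carrier M"
    then obtain u where u: "u \<in> carrier_vec n" "x = \<psi> u" using ex by meson
    show "a \<odot>\<^bsub>M\<^esub> x \<in> carrier M"
      using u smult[of u a] im[of "a \<cdot>\<^sub>v u"] by simp
    fix b
    show "(a \<oplus>\<^bsub>class_ring\<^esub> b) \<odot>\<^bsub>M\<^esub> x = a \<odot>\<^bsub>M\<^esub> x \<oplus>\<^bsub>M\<^esub> b \<odot>\<^bsub>M\<^esub> x"
      using u smult[of u a] smult[of u b] smult[of u "a + b"] add[of "a \<cdot>\<^sub>v u" "b \<cdot>\<^sub>v u"]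
      by (simp add: class_ring_simps add_smult_distrib_vec)
    show "(a \<otimes>\<^bsub>class_ring\<^esub> b) \<odot>\<^bsub>M\<^esub> x = a \<odot>\<^bsub>M\<^esub> (b \<odot>\<^bsub>M\<^esub> x)"
      using u smult[of u b] smult[of "b \<cdot>\<^sub>v u" a] smult[of u "a * b"]
      by (simp add: class_ring_simps smult_smult_assoc)
    fix y assume "y \<in> carrier M"
    then obtain v where v: "v \<in> carrier_vec n" "y = \<psi> v" using ex by meson
    show "a \<odot>\<^bsub>M\<^esub> (x \<oplus>\<^bsub>M\<^esub> y) = a \<odot>\<^bsub>M\<^esub> x \<oplus>\<^bsub>M\<^esub> a \<odot>\<^bsub>M\<^esub> y"
      using u v smult[of u a] smult[of v a] smult[of "u + v" a] add[of u v]
        add[of "a \<cdot>\<^sub>v u" "a \<cdot>\<^sub>v v"] by (simp add: smult_add_distrib_vec)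
  next
    fix x assume "x \<in> carrier M"
    then obtain u where u: "u \<in> carrier_vec n" "x = \<psi> u" using ex by meson
    then show "\<one>\<^bsub>class_ring :: 'a ring\<^esub> \<odot>\<^bsub>M\<^esub> x = x"
      using smult[of u 1] by (simp add: class_ring_simps)
  qed
  interpret W: vectorspace class_ring M
    using M_module fld by (simp add: vectorspace_def)
  interpret V: vec_space "TYPE('a)" n .
  interpret lm: linear_map class_ring V.V M \<psi>
  proof -
    have "\<psi> \<in> LinearCombinations.module_hom class_ring V.V M"
      using im add smult by (auto simp: LinearCombinations.module_hom_def module_vec_simps)
    then show "linear_map class_ring V.V M \<psi>"
      unfolding linear_map_def mod_hom_def mod_hom_axioms_def
      using V.module_axioms V.vectorspace_axioms W.vectorspace_axioms M_module by auto
  qed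
  have inj: "inj_on \<psi> (carrier V.V)" and surj: "\<psi> ` carrier V.V = carrier M"
    using bij by (auto simp: bij_betw_def module_vec_simps)
  show ?thesis
    unfolding has_dim_def
    using lm.surj_fin_dim[OF V.fin_dim surj] lm.dim_eq[OF V.fin_dim inj surj] V.dim_is_n
      W.vectorspace_axioms by simp
qed

definition fun_subspace :: "('b \<Rightarrow> 'a::field) set \<Rightarrow> bool" where
  "fun_subspace N \<longleftrightarrow> (\<lambda>_. 0) \<in> N \<and> (\<forall>f\<in>N. \<forall>h\<in>N. (\<lambda>x. f x + h x) \<in> N) \<and>
     (\<forall>c. \<forall>f\<in>N. (\<lambda>x. c * f x) \<in> N)"

lemma fun_subspaceD:
  assumes "fun_subspace N"
  shows "(\<lambda>_. 0) \<in> N"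
    and "f \<in> N \<Longrightarrow> h \<in> N \<Longrightarrow> (\<lambda>x. f x + h x) \<in> N"
    and "f \<in> N \<Longrightarrow> (\<lambda>x. c * f x) \<in> N"
    and "f \<in> N \<Longrightarrow> h \<in> N \<Longrightarrow> (\<lambda>x. f x - h x) \<in> N"
proof -
  show a: "(\<lambda>_. 0) \<in> N" and b: "f \<in> N \<Longrightarrow> h \<in> N \<Longrightarrow> (\<lambda>x. f x + h x) \<in> N"
    and c: "f \<in> N \<Longrightarrow> (\<lambda>x. c * f x) \<in> N" for f h c
    using assms by (auto simp: fun_subspace_def)
  show "f \<in> N \<Longrightarrow> h \<in> N \<Longrightarrow> (\<lambda>x. f x - h x) \<in> N"
    using b[of f "\<lambda>x. (-1) * h x"] c[of h "-1"] by simp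
qed

lemma fun_subspace_sum:
  assumes N: "fun_subspace N" and "\<And>j. j \<in> J \<Longrightarrow> f j \<in> N"
  shows "(\<lambda>x. \<Sum>j\<in>J. f j x) \<in> N"
  using assms(2)
proof (induction J rule: infinite_finite_induct)
  case (insert j J)
  then show ?case using fun_subspaceD(2)[OF N, of "f j" "\<lambda>x. \<Sum>j\<in>J. f j x"] by simp
qed (use fun_subspaceD(1)[OF N] in simp_all)

definition coh_class ::
    "'a::field mat set \<Rightarrow> nat \<Rightarrow> ('a mat list \<Rightarrow> 'a) \<Rightarrow> ('a mat list \<Rightarrow> 'a) set" where
  "coh_class g i f = coboundaries g i +>\<^bsub>cocycle_module g i\<^esub> f"

lemma coh_class_eq: "coh_class g i f = {\<lambda>x. h x + f x | h. h \<in> coboundaries g i}"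
  by (auto simp: coh_class_def a_r_coset_def r_coset_def cocycle_module_def)

lemma coh_classI: "h \<in> coboundaries g i \<Longrightarrow> w = (\<lambda>x. h x + f x) \<Longrightarrow> w \<in> coh_class g i f"
  unfolding coh_class_eq by blast

lemma coh_class_add:
  assumes N: "fun_subspace (coboundaries g i)"
  shows "coh_class g i f <+>\<^bsub>cocycle_module g i\<^esub> coh_class g i h = coh_class g i (\<lambda>x. f x + h x)"
    (is "?L = ?R")
proof
  have L: "?L = {\<lambda>x. u x + v x | u v. u \<in> coh_class g i f \<and> v \<in> coh_class g i h}"
    by (auto simp: set_add_def set_mult_def cocycle_module_def)
  show "?L \<subseteq> ?R"
  proof
    fix w assume "w \<in> ?L"
    then obtain u v where u: "u \<in> coboundaries g i" and v: "v \<in> coboundaries g i"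
      and w: "w = (\<lambda>x. (u x + f x) + (v x + h x))"
      unfolding L by (auto simp: coh_class_eq)
    show "w \<in> ?R"
      by (rule coh_classI[OF fun_subspaceD(2)[OF N u v]]) (simp add: w algebra_simps)
  qed
  show "?R \<subseteq> ?L"
  proof
    fix w assume "w \<in> ?R"
    then obtain u where u: "u \<in> coboundaries g i" and w: "w = (\<lambda>x. u x + (f x + h x))"
      unfolding coh_class_eq by auto
    have w': "w = (\<lambda>x. (u x + f x) + (0 + h x))" unfolding w by (simp add: algebra_simps)
    have "(\<lambda>x. u x + f x) \<in> coh_class g i f" using u unfolding coh_class_eq by blast
    moreover have "(\<lambda>x. 0 + h x) \<in> coh_class g i h"
      using fun_subspaceD(1)[OF N] unfolding coh_class_eq by (force simp del: add_0)
    ultimately show "w \<in> ?L" unfolding L mem_Collect_eq using w' by (intro exI conjI)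
  qed
qed

lemma coh_class_eq_iff:
  assumes N: "fun_subspace (coboundaries g i)"
  shows "coh_class g i f = coh_class g i h \<longleftrightarrow> (\<lambda>x. f x - h x) \<in> coboundaries g i"
proof
  assume *: "coh_class g i f = coh_class g i h"
  have "f \<in> coh_class g i f"
    using fun_subspaceD(1)[OF N] unfolding coh_class_eq by (force simp del: add_0)
  with * obtain u where u: "u \<in> coboundaries g i" and "f = (\<lambda>x. u x + h x)"
    unfolding coh_class_eq by auto
  then show "(\<lambda>x. f x - h x) \<in> coboundaries g i" by simp
next
  assume *: "(\<lambda>x. f x - h x) \<in> coboundaries g i"
  show "coh_class g i f = coh_class g i h"
  proof (intro equalityI subsetI)
    fix w assume "w \<in> coh_class g i f"
    then obtain u where u: "u \<in> coboundaries g i" and w: "w = (\<lambda>x. u x + f x)"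
      unfolding coh_class_eq by auto
    show "w \<in> coh_class g i h"
      by (rule coh_classI[OF fun_subspaceD(2)[OF N u *]]) (simp add: w)
  next
    fix w assume "w \<in> coh_class g i h"
    then obtain u where u: "u \<in> coboundaries g i" and w: "w = (\<lambda>x. u x + h x)"
      unfolding coh_class_eq by auto
    show "w \<in> coh_class g i f"
      by (rule coh_classI[OF fun_subspaceD(4)[OF N u *]]) (simp add: w)
  qed
qed

lemma coh_class_smult:
  assumes N: "fun_subspace (coboundaries g i)"
  shows "(\<Union>x\<in>coh_class g i f. coh_class g i (c \<odot>\<^bsub>cocycle_module g i\<^esub> x)) =
    coh_class g i (\<lambda>x. c * f x)"
proof -
  have f: "f \<in> coh_class g i f"
    using fun_subspaceD(1)[OF N] unfolding coh_class_eq by (force simp del: add_0)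
  have "coh_class g i (c \<odot>\<^bsub>cocycle_module g i\<^esub> w) = coh_class g i (\<lambda>x. c * f x)"
    if w: "w \<in> coh_class g i f" for w
  proof -
    from w obtain u where u: "u \<in> coboundaries g i" and "w = (\<lambda>x. u x + f x)"
      unfolding coh_class_eq by auto
    then show ?thesis
      using fun_subspaceD(3)[OF N u, of c]
      by (subst coh_class_eq_iff[OF N]) (simp add: cocycle_module_def algebra_simps)
  qed
  with f show ?thesis by blast
qed

lemma graded_cohomology_sel:
  "carrier (graded_cohomology g gr i k) = coh_class g i ` (cocycles g i \<inter> graded_cochains g gr i k)"
  "\<zero>\<^bsub>graded_cohomology g gr i k\<^esub> = coboundaries g i"
  "add (graded_cohomology g gr i k) = (<+>\<^bsub>cocycle_module g i\<^esub>)"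
  "module.smult (graded_cohomology g gr i k) =
     (\<lambda>c X. \<Union>x\<in>X. coh_class g i (c \<odot>\<^bsub>cocycle_module g i\<^esub> x))"
  by (simp_all add: graded_cohomology_def cohomology_def quot_module_def coh_class_def)

lemma coh_class_zero: "coh_class g i (\<lambda>_. 0) = coboundaries g i"
  unfolding coh_class_eq by simp

text \<open>Both criteria below work with representatives only: a class vanishes iff its representative is a
coboundary, and coset operations are the operations on representatives.\<close>

lemma graded_cohomology_trivial:
  assumes N: "fun_subspace (coboundaries g i)"
    and U: "fun_subspace (cocycles g i \<inter> graded_cochains g gr i k)"
    and bd: "cocycles g i \<inter> graded_cochains g gr i k \<subseteq> coboundaries g i"
  shows "carrier (graded_cohomology g gr i k) = {\<zero>\<^bsub>graded_cohomology g gr i k\<^esub>}"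
proof -
  have "coh_class g i f = coboundaries g i" if "f \<in> coboundaries g i" for f
    using that coh_class_eq_iff[OF N, of f "\<lambda>_. 0"] coh_class_zero[of g i] by simp
  with bd fun_subspaceD(1)[OF U] show ?thesis
    unfolding graded_cohomology_sel by force
qed

text \<open>The functionals \<open>\<phi> j\<close> descend to cohomology and are dual to the classes of the \<open>z j\<close>, so the latter
are independent; the last premise says that they generate.\<close>

lemma graded_cohomology_has_dim:
  fixes z :: "nat \<Rightarrow> 'a::field mat list \<Rightarrow> 'a" and \<phi> :: "nat \<Rightarrow> ('a mat list \<Rightarrow> 'a) \<Rightarrow> 'a"
  assumes N: "fun_subspace (coboundaries g i)"
    and U: "fun_subspace (cocycles g i \<inter> graded_cochains g gr i k)"
    and z: "\<And>j. j < n \<Longrightarrow> z j \<in> cocycles g i \<inter> graded_cochains g gr i k"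
    and add: "\<And>j f h. \<phi> j (\<lambda>x. f x + h x) = \<phi> j f + \<phi> j h"
    and smult: "\<And>j c f. \<phi> j (\<lambda>x. c * f x) = c * \<phi> j f"
    and bd: "\<And>j f. j < n \<Longrightarrow> f \<in> coboundaries g i \<Longrightarrow> \<phi> j f = 0"
    and dual: "\<And>j l. j < n \<Longrightarrow> l < n \<Longrightarrow> \<phi> j (z l) = (if j = l then 1 else 0)"
    and split: "\<And>f. f \<in> cocycles g i \<inter> graded_cochains g gr i k \<Longrightarrow>
       (\<lambda>x. f x - (\<Sum>j<n. \<phi> j f * z j x)) \<in> coboundaries g i"
  shows "has_dim (graded_cohomology g gr i k) n"
proof (rule has_dim_if_iso)
  define comb :: "'a vec \<Rightarrow> 'a mat list \<Rightarrow> 'a" where "comb v = (\<lambda>x. \<Sum>j<n. v $ j * z j x)" for v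
  let ?\<psi> = "\<lambda>v. coh_class g i (comb v)"
  have comb: "comb v \<in> cocycles g i \<inter> graded_cochains g gr i k" for v
    unfolding comb_def by (intro fun_subspace_sum[OF U] fun_subspaceD(3)[OF U] z) simp
  have sum: "\<phi> j (\<lambda>x. \<Sum>l\<in>L. F l x) = (\<Sum>l\<in>L. \<phi> j (F l))" if "finite L" for j L and F :: "nat \<Rightarrow> _"
    using that
  proof (induction L)
    case empty
    show ?case using smult[of j 0 "\<lambda>_. 0"] by simp
  next
    case (insert l L)
    then show ?case using add[of j "F l" "\<lambda>x. \<Sum>l\<in>L. F l x"] by simp
  qed
  have \<phi>_comb: "\<phi> j (comb v) = v $ j" if "j < n" for j v
    using that unfolding comb_def sum[OF finite_lessThan] smult
    by (simp add: dual if_distrib sum.delta cong: if_cong)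
  have \<phi>_diff: "\<phi> j (\<lambda>x. f x - h x) = \<phi> j f - \<phi> j h" for j f h
    using add[of j f "\<lambda>x. (-1) * h x"] smult[of j "-1" h] by simp
  show "bij_betw ?\<psi> (carrier_vec n) (carrier (graded_cohomology g gr i k))"
    unfolding bij_betw_def
  proof
    show "inj_on ?\<psi> (carrier_vec n)"
    proof (rule inj_onI)
      fix u v assume uv: "u \<in> carrier_vec n" "v \<in> carrier_vec n" and "?\<psi> u = ?\<psi> v"
      then have "(\<lambda>x. comb u x - comb v x) \<in> coboundaries g i"
        by (simp add: coh_class_eq_iff[OF N])
      then have "\<phi> j (comb u) = \<phi> j (comb v)" if "j < n" for j
        using bd[OF that, of "\<lambda>x. comb u x - comb v x"] \<phi>_diff[of j "comb u" "comb v"] by simp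
      then show "u = v" using uv by (intro eq_vecI) (auto simp: \<phi>_comb)
    qed
    show "?\<psi> ` carrier_vec n = carrier (graded_cohomology g gr i k)"
      unfolding graded_cohomology_sel
    proof (intro equalityI subsetI)
      fix X assume "X \<in> coh_class g i ` (cocycles g i \<inter> graded_cochains g gr i k)"
      then obtain f where f: "f \<in> cocycles g i \<inter> graded_cochains g gr i k"
        and X: "X = coh_class g i f" by auto
      have "X = ?\<psi> (vec n (\<lambda>j. \<phi> j f))"
        using split[OF f] unfolding X coh_class_eq_iff[OF N] comb_def by simp
      then show "X \<in> ?\<psi> ` carrier_vec n" by (rule image_eqI) simp
    qed (use comb in auto)
  qed
  show "?\<psi> (0\<^sub>v n) = \<zero>\<^bsub>graded_cohomology g gr i k\<^esub>"
    unfolding graded_cohomology_sel coh_class_zero[symmetric] by (simp add: comb_def)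
  show "?\<psi> (u + v) = ?\<psi> u \<oplus>\<^bsub>graded_cohomology g gr i k\<^esub> ?\<psi> v"
    if "u \<in> carrier_vec n" "v \<in> carrier_vec n" for u v
  proof -
    have "comb (u + v) = (\<lambda>x. comb u x + comb v x)"
      using that by (simp add: comb_def ring_distribs sum.distrib)
    then show ?thesis by (simp add: graded_cohomology_sel coh_class_add[OF N])
  qed
  show "?\<psi> (c \<cdot>\<^sub>v v) = c \<odot>\<^bsub>graded_cohomology g gr i k\<^esub> ?\<psi> v" if "v \<in> carrier_vec n" for c v
  proof -
    have "comb (c \<cdot>\<^sub>v v) = (\<lambda>x. c * comb v x)"
      using that by (simp add: comb_def sum_distrib_left mult.assoc)
    then show ?thesis by (simp add: graded_cohomology_sel coh_class_smult[OF N])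
  qed
qed

section \<open>Alternating forms and contraction\<close>

definition contract :: "'a mat \<Rightarrow> ('a mat list \<Rightarrow> 'a) \<Rightarrow> 'a mat list \<Rightarrow> 'a" where
  "contract x f = (\<lambda>xs. f (x # xs))"

lemma contract_apply: "contract x f xs = f (x # xs)"
  by (simp add: contract_def)

text \<open>The Lie derivative, by recursion on the arguments. The membership test keeps the result zero outside
lists over \<open>g\<close>, as cochains have to be.\<close>

fun lie_deriv :: "'a::field mat set \<Rightarrow> 'a mat \<Rightarrow> ('a mat list \<Rightarrow> 'a) \<Rightarrow> 'a mat list \<Rightarrow> 'a" where
  "lie_deriv g x f [] = 0"
| "lie_deriv g x f (y # ys) =
     (if y \<in> g then lie_deriv g x (contract y f) ys - f (lie_bracket x y # ys) else 0)"

lemma Cons_in_arg_lists [simp]: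
  "x # xs \<in> arg_lists g (Suc i) \<longleftrightarrow> x \<in> g \<and> xs \<in> arg_lists g i"
  by (auto simp: arg_lists_def)

lemma arg_lists_0 [simp]: "arg_lists g 0 = {[]}"
  by (auto simp: arg_lists_def)

lemma Nil_notin_arg_lists [simp]: "[] \<notin> arg_lists g (Suc i)"
  by (auto simp: arg_lists_def)

lemma cochains_subspace: "fun_subspace (cochains g i)"
  unfolding fun_subspace_def cochains_def by (auto simp: algebra_simps)

lemma cochain_outside: "f \<in> cochains g i \<Longrightarrow> xs \<notin> arg_lists g i \<Longrightarrow> f xs = 0"
  by (simp add: cochains_def)

lemma cochain_slot_add:
  "f \<in> cochains g i \<Longrightarrow> xs \<in> arg_lists g i \<Longrightarrow> p < i \<Longrightarrow> x \<in> g \<Longrightarrow> y \<in> g \<Longrightarrow>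
    f (xs[p := x + y]) = f (xs[p := x]) + f (xs[p := y])"
  by (simp add: cochains_def)

lemma cochain_slot_smult:
  "f \<in> cochains g i \<Longrightarrow> xs \<in> arg_lists g i \<Longrightarrow> p < i \<Longrightarrow> x \<in> g \<Longrightarrow>
    f (xs[p := c \<cdot>\<^sub>m x]) = c * f (xs[p := x])"
  by (simp add: cochains_def)

lemma cochain_alternating:
  "f \<in> cochains g i \<Longrightarrow> xs \<in> arg_lists g i \<Longrightarrow> p < q \<Longrightarrow> q < i \<Longrightarrow> xs ! p = xs ! q \<Longrightarrow> f xs = 0"
  unfolding cochains_def by blast

lemma cochains_0_iff: "f \<in> cochains g 0 \<longleftrightarrow> (\<forall>xs. xs \<noteq> [] \<longrightarrow> f xs = 0)"
  by (auto simp: cochains_def)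

lemma lie_deriv_add: "lie_deriv g x (\<lambda>xs. f xs + h xs) ys = lie_deriv g x f ys + lie_deriv g x h ys"
proof (induction ys arbitrary: f h)
  case (Cons y ys)
  show ?case
    using Cons[of "contract y f" "contract y h"] by (simp add: contract_def)
qed simp

lemma lie_deriv_scale: "lie_deriv g x (\<lambda>xs. c * f xs) ys = c * lie_deriv g x f ys"
proof (induction ys arbitrary: f)
  case (Cons y ys)
  show ?case
    using Cons[of "contract y f"] by (simp add: contract_def algebra_simps)
qed simp

lemma ce_diff_add: "ce_diff g i (\<lambda>xs. f xs + h xs) = (\<lambda>xs. ce_diff g i f xs + ce_diff g i h xs)"
  unfolding ce_diff_def by (auto simp: ring_distribs sum.distrib)

lemma ce_diff_scale: "ce_diff g i (\<lambda>xs. c * f xs) = (\<lambda>xs. c * ce_diff g i f xs)"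
  unfolding ce_diff_def
  by (auto simp: sum_distrib_left mult.left_commute[of c] fun_eq_iff simp del: sum.lessThan_Suc)

locale matrix_lie_algebra =
  fixes g :: "'a::field mat set" and n :: nat
  assumes carrier: "x \<in> g \<Longrightarrow> x \<in> carrier_mat n n"
    and add_closed: "x \<in> g \<Longrightarrow> y \<in> g \<Longrightarrow> x + y \<in> g"
    and smult_closed: "x \<in> g \<Longrightarrow> c \<cdot>\<^sub>m x \<in> g"
    and bracket_closed: "x \<in> g \<Longrightarrow> y \<in> g \<Longrightarrow> lie_bracket x y \<in> g"
begin

lemma bracket_add_right:
  "x \<in> g \<Longrightarrow> y \<in> g \<Longrightarrow> z \<in> g \<Longrightarrow> lie_bracket x (y + z) = lie_bracket x y + lie_bracket x z"
  using carrier[of x] carrier[of y] carrier[of z]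
  by (intro eq_matI) (auto simp: lie_bracket_def scalar_prod_add_distrib[of _ n] add_scalar_prod_distrib[of _ n])

lemma bracket_add_left:
  "x \<in> g \<Longrightarrow> y \<in> g \<Longrightarrow> z \<in> g \<Longrightarrow> lie_bracket (x + y) z = lie_bracket x z + lie_bracket y z"
  using carrier[of x] carrier[of y] carrier[of z]
  by (intro eq_matI) (auto simp: lie_bracket_def scalar_prod_add_distrib[of _ n] add_scalar_prod_distrib[of _ n])

lemma bracket_smult_right: "x \<in> g \<Longrightarrow> y \<in> g \<Longrightarrow> lie_bracket x (c \<cdot>\<^sub>m y) = c \<cdot>\<^sub>m lie_bracket x y"
  using carrier[of x] carrier[of y]
  by (intro eq_matI) (auto simp: lie_bracket_def algebra_simps)

lemma bracket_smult_left: "x \<in> g \<Longrightarrow> y \<in> g \<Longrightarrow> lie_bracket (c \<cdot>\<^sub>m x) y = c \<cdot>\<^sub>m lie_bracket x y"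
  using carrier[of x] carrier[of y]
  by (intro eq_matI) (auto simp: lie_bracket_def algebra_simps)

lemma bracket_self: "x \<in> g \<Longrightarrow> lie_bracket x x = 0 \<cdot>\<^sub>m x"
  using carrier[of x] by (intro eq_matI) (auto simp: lie_bracket_def)

text \<open>Induction on the degree of a form becomes possible once forms of degree \<open>i + 1\<close> are seen as linear
maps into forms of degree \<open>i\<close>. That a form is alternating only has to be tested on repetitions in the
first two slots: linearity then yields antisymmetry there, and a repeated argument can be moved to
the second slot, or the repetition is already one of the contracted form.\<close>

lemma cochains_Suc_iff:
  "f \<in> cochains g (Suc i) \<longleftrightarrow>
     f [] = 0 \<and> (\<forall>x. x \<notin> g \<longrightarrow> contract x f = (\<lambda>_. 0)) \<and> (\<forall>x\<in>g. contract x f \<in> cochains g i) \<and>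
     (\<forall>x\<in>g. \<forall>y\<in>g. \<forall>xs. f ((x + y) # xs) = f (x # xs) + f (y # xs)) \<and>
     (\<forall>x\<in>g. \<forall>c xs. f ((c \<cdot>\<^sub>m x) # xs) = c * f (x # xs)) \<and>
     (\<forall>x\<in>g. \<forall>xs. f (x # x # xs) = 0)" (is "_ \<longleftrightarrow> ?R")
proof
  assume f: "f \<in> cochains g (Suc i)"
  have out: "f xs = 0" if "xs \<notin> arg_lists g (Suc i)" for xs
    using f that by (rule cochain_outside)
  note add = cochain_slot_add[OF f] and sm = cochain_slot_smult[OF f] and alt = cochain_alternating[OF f]
  have "contract x f \<in> cochains g i" if "x \<in> g" for x
    unfolding cochains_def
  proof (safe, goal_cases)
    case (1 xs) then show ?case using out[of "x # xs"] by (simp add: contract_apply)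
  next
    case (2 xs p y z)
    then show ?case using add[of "x # xs" "Suc p" y z] that by (simp add: contract_apply)
  next
    case (3 xs p y c)
    then show ?case using sm[of "x # xs" "Suc p" y c] that by (simp add: contract_apply)
  next
    case (4 xs p q)
    then show ?case using alt[of "x # xs" "Suc p" "Suc q"] that by (simp add: contract_apply)
  qed
  moreover have "f ((x + y) # xs) = f (x # xs) + f (y # xs)" if "x \<in> g" "y \<in> g" for x y xs
    using add[of "x # xs" 0 x y] out[of "(x + y) # xs"] out[of "x # xs"] out[of "y # xs"] that
    by (cases "xs \<in> arg_lists g i") auto
  moreover have "f ((c \<cdot>\<^sub>m x) # xs) = c * f (x # xs)" if "x \<in> g" for x c xs
    using sm[of "x # xs" 0 x c] out[of "(c \<cdot>\<^sub>m x) # xs"] out[of "x # xs"] that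
    by (cases "xs \<in> arg_lists g i") auto
  moreover have "f (x # x # xs) = 0" if "x \<in> g" for x xs
  proof (cases "x # x # xs \<in> arg_lists g (Suc i)")
    case True
    then have "0 < i" by (auto simp: arg_lists_def)
    with True show ?thesis using alt[of "x # x # xs" 0 1] by simp
  qed (rule out)
  ultimately show ?R using out by (auto simp: contract_def)
next
  show "f \<in> cochains g (Suc i)" if "?R"
    using that
  proof (induction i arbitrary: f)
    case 0
    then have out: "f xs = 0" if "xs \<notin> arg_lists g (Suc 0)" for xs
      using that by (cases xs) (auto simp: contract_def cochains_0_iff fun_eq_iff)
    show ?case
      unfolding cochains_def
    proof (safe, goal_cases)
      case (1 xs) then show ?case by (rule out)
    next
      case (2 xs p y z) then show ?case using 0 by (cases xs) auto
    next
      case (3 xs p y c) then show ?case using 0 by (cases xs) auto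
    qed
  next
    case (Suc i)
    have add: "f ((x + y) # xs) = f (x # xs) + f (y # xs)" if "x \<in> g" "y \<in> g" for x y xs
      using Suc.prems that by blast
    have c: "contract x f \<in> cochains g (Suc i)" if "x \<in> g" for x
      using Suc.prems that by blast
    have out: "f xs = 0" if "xs \<notin> arg_lists g (Suc (Suc i))" for xs
    proof (cases xs)
      case (Cons x ys)
      with that Suc.prems cochain_outside[OF c[of x], of ys] show ?thesis
        by (cases "x \<in> g") (auto simp: contract_def fun_eq_iff)
    qed (use Suc.prems in simp)
    have add2: "f (x # (y + z) # xs) = f (x # y # xs) + f (x # z # xs)"
      if "x \<in> g" "y \<in> g" "z \<in> g" "xs \<in> arg_lists g i" for x y z xs
    proof -
      have "contract x f ((y # xs)[0 := y + z]) =
          contract x f ((y # xs)[0 := y]) + contract x f ((y # xs)[0 := z])"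
        using that by (intro cochain_slot_add[OF c]) auto
      then show ?thesis by (simp add: contract_apply)
    qed
    have anti: "f (x # y # xs) = - f (y # x # xs)"
      if "x \<in> g" "y \<in> g" "xs \<in> arg_lists g i" for x y xs
    proof -
      have "f ((x + y) # (x + y) # xs) = 0" "f (x # x # xs) = 0" "f (y # y # xs) = 0"
        using Suc.prems that add_closed by blast+
      then have "f (x # y # xs) + f (y # x # xs) = 0"
        using that by (simp add: add add2 add_closed add.commute)
      then show ?thesis by (simp add: eq_neg_iff_add_eq_0)
    qed
    show ?case
      unfolding cochains_def
    proof (safe, goal_cases)
      case (1 xs) then show ?case by (rule out)
    next
      case (2 xs p y z)
      then obtain x ys where xs: "xs = x # ys" "x \<in> g" "ys \<in> arg_lists g (Suc i)"
        by (cases xs) auto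
      show ?case
      proof (cases p)
        case 0
        then show ?thesis using add 2 xs by simp
      next
        case (Suc p')
        with cochain_slot_add[OF c[of x], of ys p' y z] 2 xs show ?thesis
          by (simp add: contract_apply)
      qed
    next
      case (3 xs p y a)
      then obtain x ys where xs: "xs = x # ys" "x \<in> g" "ys \<in> arg_lists g (Suc i)"
        by (cases xs) auto
      show ?case
      proof (cases p)
        case 0
        then show ?thesis using Suc.prems 3 xs by auto
      next
        case (Suc p')
        with cochain_slot_smult[OF c[of x], of ys p' y a] 3 xs show ?thesis
          by (simp add: contract_apply)
      qed
    next
      case (4 xs p q)
      then obtain x y ys where xs: "xs = x # y # ys" "x \<in> g" "y \<in> g" "ys \<in> arg_lists g i"
        by (cases xs; cases "tl xs") auto
      have c_alt: "f (w # ws) = 0" if "w \<in> g" "ws \<in> arg_lists g (Suc i)" "a < b" "b < Suc i"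
        "ws ! a = ws ! b" for w ws a b
        using cochain_alternating[OF c[of w], of ws a b] that by (simp add: contract_apply)
      obtain q' where q: "q = Suc q'" using 4 by (cases q) auto
      show ?case
      proof (cases p)
        case 0
        show ?thesis
        proof (cases q')
          case 0
          then have "xs = x # x # ys" using 4 \<open>p = 0\<close> xs q by simp
          then show ?thesis using Suc.prems xs(2) by simp
        next
          case (Suc q'')
          have "f xs = - f (y # x # ys)" unfolding xs(1) by (rule anti[OF xs(2-4)])
          also have "f (y # x # ys) = 0"
            using c_alt[of y "x # ys" 0 "Suc q''"] xs 4 \<open>p = 0\<close> q Suc by simp
          finally show ?thesis by simp
        qed
      next
        case (Suc p')
        show ?thesis
          using c_alt[of x "y # ys" p' q'] xs 4 q Suc by simp
      qed
    qed
  qed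
qed

lemma cochain_Nil: "f \<in> cochains g (Suc i) \<Longrightarrow> f [] = 0"
  by (simp add: cochains_Suc_iff)

lemma contract_cochain: "f \<in> cochains g (Suc i) \<Longrightarrow> x \<in> g \<Longrightarrow> contract x f \<in> cochains g i"
  by (simp add: cochains_Suc_iff)

lemma cochain_notin: "f \<in> cochains g (Suc i) \<Longrightarrow> x \<notin> g \<Longrightarrow> f (x # xs) = 0"
  by (auto simp: cochains_Suc_iff contract_def fun_eq_iff)

lemma cochain_add:
  "f \<in> cochains g i \<Longrightarrow> x \<in> g \<Longrightarrow> y \<in> g \<Longrightarrow> f ((x + y) # xs) = f (x # xs) + f (y # xs)"
  by (cases i) (auto simp: cochains_Suc_iff cochains_0_iff)

lemma cochain_smult: "f \<in> cochains g i \<Longrightarrow> x \<in> g \<Longrightarrow> f ((c \<cdot>\<^sub>m x) # xs) = c * f (x # xs)"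
  by (cases i) (auto simp: cochains_Suc_iff cochains_0_iff)

lemma cochain_repeat: "f \<in> cochains g i \<Longrightarrow> x \<in> g \<Longrightarrow> f (x # x # xs) = 0"
  by (cases i) (auto simp: cochains_Suc_iff cochains_0_iff)

text \<open>Contractions of forms of degree \<open>0\<close> are zero; the existential degree avoids a case distinction in the
inductions over argument lists below.\<close>

lemma contract_cochain_or_zero:
  assumes "f \<in> cochains g i" "x \<in> g"
  obtains j where "contract x f \<in> cochains g j"
proof (cases i)
  case 0
  then have "contract x f = (\<lambda>_. 0)" using assms by (auto simp: cochains_0_iff contract_def)
  then show ?thesis using that[of 0] fun_subspaceD(1)[OF cochains_subspace] by metis
qed (use that assms contract_cochain in blast)

lemma cochain_antisym:
  assumes f: "f \<in> cochains g i" and x: "x \<in> g" and y: "y \<in> g"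
  shows "f (x # y # xs) = - f (y # x # xs)"
proof -
  have add2: "f (u # (x + y) # xs) = f (u # x # xs) + f (u # y # xs)" if u: "u \<in> g" for u
  proof -
    obtain j where "contract u f \<in> cochains g j" using f u by (rule contract_cochain_or_zero)
    from cochain_add[OF this x y, of xs] show ?thesis by (simp add: contract_apply)
  qed
  have "f ((x + y) # (x + y) # xs) = 0" "f (x # x # xs) = 0" "f (y # y # xs) = 0"
    using cochain_repeat[OF f] x y add_closed by blast+
  then have "f (x # y # xs) + f (y # x # xs) = 0"
    using x y by (simp add: cochain_add[OF f] add2 add_closed add.commute)
  then show ?thesis by (simp add: eq_neg_iff_add_eq_0)
qed

lemma contract_add:
  "f \<in> cochains g i \<Longrightarrow> x \<in> g \<Longrightarrow> y \<in> g \<Longrightarrow>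
    contract (x + y) f = (\<lambda>xs. contract x f xs + contract y f xs)"
  by (simp add: contract_def cochain_add)

lemma contract_smult:
  "f \<in> cochains g i \<Longrightarrow> x \<in> g \<Longrightarrow> contract (c \<cdot>\<^sub>m x) f = (\<lambda>xs. c * contract x f xs)"
  by (simp add: contract_def cochain_smult)

lemma contract_repeat: "f \<in> cochains g i \<Longrightarrow> x \<in> g \<Longrightarrow> contract x (contract x f) = (\<lambda>_. 0)"
  by (simp add: contract_def cochain_repeat)

lemma lie_deriv_zero: "lie_deriv g x (\<lambda>_. 0) ys = 0"
  using lie_deriv_scale[of g x 0 "\<lambda>_. 0" ys] by simp

section \<open>Cartan calculus\<close>

lemma contract_lie_deriv:
  "y \<in> g \<Longrightarrow> contract y (lie_deriv g x f) = (\<lambda>ys. lie_deriv g x (contract y f) ys - contract (lie_bracket x y) f ys)"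
  by (simp add: contract_def)

lemma lie_deriv_cochain:
  assumes x: "x \<in> g"
  shows "f \<in> cochains g i \<Longrightarrow> lie_deriv g x f \<in> cochains g i"
proof (induction i arbitrary: f)
  case 0
  have "lie_deriv g x f ys = 0" for ys
  proof (cases ys)
    case (Cons y zs)
    have "contract y f = (\<lambda>_. 0)" using 0 by (simp add: contract_def cochains_0_iff)
    then show ?thesis using 0 Cons by (simp add: lie_deriv_zero cochains_0_iff)
  qed simp
  then show ?case by (simp add: cochains_0_iff)
next
  case (Suc i)
  note f = Suc.prems
  show ?case
    unfolding cochains_Suc_iff
  proof (intro conjI allI ballI impI)
    show "lie_deriv g x f [] = 0" by simp
    show "contract y (lie_deriv g x f) = (\<lambda>_. 0)" if "y \<notin> g" for y
      using that by (simp add: contract_def)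
    show "contract y (lie_deriv g x f) \<in> cochains g i" if y: "y \<in> g" for y
      unfolding contract_lie_deriv[OF y]
      by (intro fun_subspaceD(4)[OF cochains_subspace] Suc.IH contract_cochain[OF f]
          bracket_closed x y)
    show "lie_deriv g x f ((y + z) # xs) = lie_deriv g x f (y # xs) + lie_deriv g x f (z # xs)"
      if "y \<in> g" "z \<in> g" for y z xs
      using that x
      by (simp add: add_closed bracket_closed contract_add[OF f] cochain_add[OF f]
          bracket_add_right lie_deriv_add)
    show "lie_deriv g x f ((c \<cdot>\<^sub>m y) # xs) = c * lie_deriv g x f (y # xs)" if "y \<in> g" for y c xs
      using that x
      by (simp add: smult_closed bracket_closed contract_smult[OF f] cochain_smult[OF f]
          bracket_smult_right lie_deriv_scale algebra_simps)
    show "lie_deriv g x f (y # y # xs) = 0" if y: "y \<in> g" for y xs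
      using y cochain_antisym[OF f y bracket_closed[OF x y], of xs]
      by (simp add: contract_repeat[OF f] lie_deriv_zero contract_apply)
  qed
qed

lemma lie_deriv_add_left:
  assumes "x \<in> g" "y \<in> g"
  shows "f \<in> cochains g i \<Longrightarrow> lie_deriv g (x + y) f zs = lie_deriv g x f zs + lie_deriv g y f zs"
proof (induction zs arbitrary: f i)
  case (Cons z zs)
  show ?case
  proof (cases "z \<in> g")
    case True
    obtain j where "contract z f \<in> cochains g j"
      using Cons.prems True by (rule contract_cochain_or_zero)
    from Cons.IH[OF this] True assms show ?thesis
      by (simp add: bracket_add_left bracket_closed cochain_add[OF Cons.prems])
  qed simp
qed simp

lemma lie_deriv_smult_left:
  assumes "x \<in> g"
  shows "f \<in> cochains g i \<Longrightarrow> lie_deriv g (c \<cdot>\<^sub>m x) f zs = c * lie_deriv g x f zs"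
proof (induction zs arbitrary: f i)
  case (Cons z zs)
  show ?case
  proof (cases "z \<in> g")
    case True
    obtain j where "contract z f \<in> cochains g j"
      using Cons.prems True by (rule contract_cochain_or_zero)
    from Cons.IH[OF this] True assms show ?thesis
      by (simp add: bracket_smult_left bracket_closed cochain_smult[OF Cons.prems] algebra_simps)
  qed simp
qed simp

text \<open>Moving the entry at position \<open>q\<close> to the front passes \<open>q\<close> other arguments.\<close>

lemma cochain_update:
  "f \<in> cochains g i \<Longrightarrow> set xs \<subseteq> g \<Longrightarrow> z \<in> g \<Longrightarrow> q < length xs \<Longrightarrow>
    f (xs[q := z]) = (-1) ^ q * f (z # nths xs (- {q}))"
proof (induction xs arbitrary: f i q)
  case (Cons x xs)
  show ?case
  proof (cases q)
    case 0
    then show ?thesis by (simp add: nths_Cons nths_all)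
  next
    case (Suc p)
    have e: "{j. Suc j \<in> - {q}} = - {p}" using Suc by auto
    obtain j where "contract x f \<in> cochains g j"
      using Cons.prems by (metis contract_cochain_or_zero list.set_intros(1) subsetD)
    from Cons.IH[OF this, of p] Cons.prems Suc
    have "f ((x # xs)[q := z]) = (-1) ^ p * f (x # z # nths xs (- {p}))"
      by (simp add: contract_apply)
    also have "f (x # z # nths xs (- {p})) = - f (z # x # nths xs (- {p}))"
      using Cons.prems by (intro cochain_antisym) auto
    finally show ?thesis unfolding nths_Cons e by (simp add: Suc)
  qed
qed simp

lemma lie_deriv_eq_sum:
  "set ys \<subseteq> g \<Longrightarrow> lie_deriv g x f ys = - (\<Sum>q<length ys. f (ys[q := lie_bracket x (ys ! q)]))"
proof (induction ys arbitrary: f)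
  case (Cons y ys)
  then show ?case
    using Cons.IH[of "contract y f"]
    by (simp add: contract_apply sum.lessThan_Suc_shift del: sum.lessThan_Suc)
qed simp

lemma ce_diff_0: "ce_diff g 0 f = (\<lambda>_. 0)"
  by (auto simp: ce_diff_def)

text \<open>Cartan's formula \<open>\<iota>\<^sub>x d = L\<^sub>x - d \<iota>\<^sub>x\<close>: in the sum over pairs of positions, the pairs containing the
position of \<open>x\<close> give the Lie derivative, and in the remaining ones \<open>x\<close> is moved in front of the
bracket at the cost of a sign.\<close>

lemma contract_ce_diff:
  assumes f: "f \<in> cochains g (Suc i)" and x: "x \<in> g"
  shows "contract x (ce_diff g (Suc i) f) =
    (\<lambda>xs. lie_deriv g x f xs - ce_diff g i (contract x f) xs)"
proof
  fix xs
  show "contract x (ce_diff g (Suc i) f) xs = lie_deriv g x f xs - ce_diff g i (contract x f) xs"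
  proof (cases "xs \<in> arg_lists g (Suc i)")
    case False
    then show ?thesis
      using cochain_outside[OF lie_deriv_cochain[OF x f]] by (simp add: ce_diff_def contract_apply)
  next
    case True
    then have len: "length xs = Suc i" and sub: "set xs \<subseteq> g" by (auto simp: arg_lists_def)
    have sgn0: "(-1) ^ (0 + Suc q) * f (lie_bracket x (xs ! q) # nths (x # xs) (- {0, Suc q})) =
        - f (xs[q := lie_bracket x (xs ! q)])" if "q < Suc i" for q
    proof -
      have e: "{j. Suc j \<in> - {0, Suc q}} = - {q}" by auto
      have "xs ! q \<in> g" using that len sub by auto
      then show ?thesis
        unfolding nths_Cons e
        using cochain_update[OF f sub bracket_closed[OF x], of "xs ! q" q] that len by simp
    qed
    have sgn1: "(-1) ^ (Suc p + Suc q) *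
          f (lie_bracket (xs ! p) (xs ! q) # nths (x # xs) (- {Suc p, Suc q})) =
        - ((-1) ^ (p + q) * contract x f (lie_bracket (xs ! p) (xs ! q) # nths xs (- {p, q})))"
      if "p < q" "q < Suc i" for p q
    proof -
      have e: "{j. Suc j \<in> - {Suc p, Suc q}} = - {p, q}" by auto
      have "xs ! p \<in> g" "xs ! q \<in> g" using that len sub by auto
      then show ?thesis
        unfolding nths_Cons e
        using cochain_antisym[OF f x bracket_closed, of "xs ! p" "xs ! q" "nths xs (- {p, q})"]
        by (simp add: contract_apply)
    qed
    have "contract x (ce_diff g (Suc i) f) xs =
      (\<Sum>q<Suc i. (-1) ^ (0 + Suc q) * f (lie_bracket x (xs ! q) # nths (x # xs) (- {0, Suc q})) +
        (\<Sum>p<q. (-1) ^ (Suc p + Suc q) *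
          f (lie_bracket (xs ! p) (xs ! q) # nths (x # xs) (- {Suc p, Suc q}))))"
      using True x unfolding contract_apply ce_diff_def
      by (subst sum.lessThan_Suc_shift) (simp add: sum.lessThan_Suc_shift del: sum.lessThan_Suc)
    also have "\<dots> = (\<Sum>q<Suc i. - f (xs[q := lie_bracket x (xs ! q)]) -
        (\<Sum>p<q. (-1) ^ (p + q) *
          contract x f (lie_bracket (xs ! p) (xs ! q) # nths xs (- {p, q}))))"
    proof (rule sum.cong[OF refl], goal_cases)
      case (1 q)
      then show ?case
        unfolding diff_conv_add_uminus sum_negf[symmetric]
        by (intro arg_cong2[of _ _ _ _ "(+)"] sum.cong refl sgn0 sgn1) auto
    qed
    also have "\<dots> = lie_deriv g x f xs - ce_diff g i (contract x f) xs"
      using True len by (simp add: lie_deriv_eq_sum[OF sub] ce_diff_def sum_subtractf sum_negf)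
    finally show ?thesis .
  qed
qed

lemma ce_diff_Nil [simp]: "ce_diff g i f [] = 0"
  by (simp add: ce_diff_def)

lemma ce_diff_zero: "ce_diff g i (\<lambda>_. 0) = (\<lambda>_. 0)"
  by (auto simp: ce_diff_def)

lemma ce_diff_notin: "x \<notin> g \<Longrightarrow> ce_diff g i f (x # xs) = 0"
  by (simp add: ce_diff_def)

text \<open>By Cartan's formula and induction. A repetition \<open>x, x\<close> gives \<open>L\<^sub>x f (x, ..) - L\<^sub>x (\<iota>\<^sub>x f) (..)\<close>, which is
\<open>f ([x, x], ..) = 0\<close> up to sign.\<close>

lemma ce_diff_cochain: "f \<in> cochains g i \<Longrightarrow> ce_diff g i f \<in> cochains g (Suc i)"
proof (induction i arbitrary: f)
  case 0
  then show ?case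
    unfolding ce_diff_0 using fun_subspaceD(1)[OF cochains_subspace] by blast
next
  case (Suc i)
  note f = Suc.prems
  have cartan: "ce_diff g (Suc i) f (x # xs) = lie_deriv g x f xs - ce_diff g i (contract x f) xs"
    if "x \<in> g" for x xs
    using contract_ce_diff[OF f that] by (simp add: fun_eq_iff contract_apply)
  show ?case
    unfolding cochains_Suc_iff[of _ "Suc i"]
  proof (intro conjI allI ballI impI)
    show "ce_diff g (Suc i) f [] = 0" by simp
    show "contract x (ce_diff g (Suc i) f) = (\<lambda>_. 0)" if "x \<notin> g" for x
      using that by (simp add: contract_def ce_diff_notin)
    show "contract x (ce_diff g (Suc i) f) \<in> cochains g (Suc i)" if x: "x \<in> g" for x
      unfolding contract_ce_diff[OF f x]
      by (intro fun_subspaceD(4)[OF cochains_subspace] lie_deriv_cochain x f Suc.IH contract_cochain[OF f])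
    show "ce_diff g (Suc i) f ((x + y) # xs) = ce_diff g (Suc i) f (x # xs) + ce_diff g (Suc i) f (y # xs)"
      if "x \<in> g" "y \<in> g" for x y xs
      using that
      by (simp add: cartan add_closed lie_deriv_add_left[OF _ _ f] contract_add[OF f] ce_diff_add)
    show "ce_diff g (Suc i) f ((c \<cdot>\<^sub>m x) # xs) = c * ce_diff g (Suc i) f (x # xs)"
      if "x \<in> g" for x c xs
      using that
      by (simp add: cartan smult_closed lie_deriv_smult_left[OF _ f] contract_smult[OF f] ce_diff_scale
          algebra_simps)
    show "ce_diff g (Suc i) f (x # x # xs) = 0" if x: "x \<in> g" for x xs
    proof -
      have "ce_diff g i (contract x f) (x # xs) = lie_deriv g x (contract x f) xs"
      proof (cases i)
        case 0
        have "lie_deriv g x (contract x f) \<in> cochains g 0" "contract x f \<in> cochains g 0"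
          using lie_deriv_cochain[OF x contract_cochain[OF f x]] contract_cochain[OF f x] 0 by auto
        moreover have "lie_deriv g x (contract x f) [] = 0" by simp
        ultimately have "lie_deriv g x (contract x f) xs = 0"
          by (cases "xs = []") (auto simp: cochains_0_iff)
        then show ?thesis unfolding 0 ce_diff_0 by simp
      next
        case (Suc j)
        have "contract x (ce_diff g i (contract x f)) xs =
          lie_deriv g x (contract x f) xs - ce_diff g j (contract x (contract x f)) xs"
          using contract_ce_diff[OF _ x, of "contract x f" j] contract_cochain[OF f x] Suc by simp
        then show ?thesis by (simp add: contract_repeat[OF f x] ce_diff_zero contract_apply)
      qed
      then show ?thesis
        using x cochain_smult[OF f x, of 0 xs] by (simp add: cartan bracket_self)
    qed
  qed
qed

lemma cocycles_subspace: "fun_subspace (cocycles g i)"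
  using cochains_subspace[of g i]
  by (auto simp: fun_subspace_def cocycles_def ce_diff_zero ce_diff_add ce_diff_scale)

lemma coboundaries_Suc: "coboundaries g (Suc i) = ce_diff g i ` cochains g i"
  by (simp add: coboundaries_def)

lemma coboundaries_0: "coboundaries g 0 = {\<lambda>_. 0}"
  by (simp add: coboundaries_def)

lemma coboundaries_subspace: "fun_subspace (coboundaries g i)"
proof (cases i)
  case 0
  then show ?thesis by (simp add: coboundaries_0 fun_subspace_def)
next
  case (Suc m)
  note S = fun_subspaceD[OF cochains_subspace[of g m]]
  show ?thesis
    unfolding fun_subspace_def Suc coboundaries_Suc
  proof (safe, goal_cases)
    case 1
    show ?case by (rule image_eqI[OF _ S(1)]) (simp add: ce_diff_zero)
  next
    case (2 _ _ f h)
    show ?case by (rule image_eqI[OF _ S(2)[OF 2]]) (simp add: ce_diff_add)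
  next
    case (3 c _ f)
    show ?case by (rule image_eqI[OF _ S(3)[OF 3]]) (simp add: ce_diff_scale)
  qed
qed

lemma graded_cochains_subspace: "fun_subspace (graded_cochains g gr i k)"
  using cochains_subspace[of g i] by (auto simp: fun_subspace_def graded_cochains_def)

lemma fun_subspace_Int: "fun_subspace A \<Longrightarrow> fun_subspace B \<Longrightarrow> fun_subspace (A \<inter> B)"
  by (auto simp: fun_subspace_def)

end

section \<open>Chains on increasing monomials\<close>

text \<open>A pair \<open>(a, T)\<close> stands for \<open>a\<close> times the wedge product of the basis vectors with indices \<open>T\<close>. Lists
make the certificates below executable; the same monomial may occur several times.\<close>

type_synonym chain = "(int \<times> nat list) list"

definition chain_scale :: "int \<Rightarrow> chain \<Rightarrow> chain" where
  "chain_scale m c = map (\<lambda>(a, T). (m * a, T)) c"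

definition chain_bind :: "chain \<Rightarrow> (nat list \<Rightarrow> chain) \<Rightarrow> chain" where
  "chain_bind c F = concat (map (\<lambda>(a, T). chain_scale a (F T)) c)"

text \<open>The wedge product of a basis vector with an increasing monomial, rewritten as an increasing one.\<close>

fun sorted_ins :: "nat \<Rightarrow> nat list \<Rightarrow> chain" where
  "sorted_ins s [] = [(1, [s])]"
| "sorted_ins s (t # T) =
     (if s < t then [(1, s # t # T)] else if s = t then []
      else map (\<lambda>(a, U). (- a, t # U)) (sorted_ins s T))"

definition wedge_chain :: "nat \<Rightarrow> chain \<Rightarrow> chain" where
  "wedge_chain s c = chain_bind c (sorted_ins s)"

text \<open>Minus the adjoint action of a basis vector on a monomial, that is, the transpose of the Lie
derivative; \<open>br\<close> are the structure constants.\<close>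

fun ad_chain :: "(nat \<Rightarrow> nat \<Rightarrow> (int \<times> nat) list) \<Rightarrow> nat \<Rightarrow> nat list \<Rightarrow> chain" where
  "ad_chain br s [] = []"
| "ad_chain br s (t # S) = wedge_chain t (ad_chain br s S) @
     chain_scale (-1) (concat (map (\<lambda>(a, u). chain_scale a (sorted_ins u S)) (br s t)))"

text \<open>The Chevalley-Eilenberg boundary, by the recursion that is dual to Cartan's formula.\<close>

fun boundary :: "(nat \<Rightarrow> nat \<Rightarrow> (int \<times> nat) list) \<Rightarrow> nat list \<Rightarrow> chain" where
  "boundary br [] = []"
| "boundary br (s # S) = ad_chain br s S @ chain_scale (-1) (wedge_chain s (boundary br S))"

fun sort_chain :: "nat list \<Rightarrow> chain" where
  "sort_chain [] = [(1, [])]"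
| "sort_chain (s # S) = wedge_chain s (sort_chain S)"

definition coef :: "chain \<Rightarrow> nat list \<Rightarrow> int" where
  "coef c T = (\<Sum>(a, U)\<leftarrow>c. if U = T then a else 0)"

definition monomials :: "nat \<Rightarrow> (nat \<Rightarrow> int) \<Rightarrow> nat \<Rightarrow> int \<Rightarrow> nat list set" where
  "monomials N deg i D =
     {T. sorted_wrt (<) T \<and> set T \<subseteq> {..<N} \<and> length T = i \<and> sum_list (map deg T) = D}"

definition chain_space :: "nat \<Rightarrow> (nat \<Rightarrow> int) \<Rightarrow> nat \<Rightarrow> int \<Rightarrow> chain set" where
  "chain_space N deg i D = {c. snd ` set c \<subseteq> monomials N deg i D}"

lemma chain_space_simps [simp]:
  "[] \<in> chain_space N deg i D"
  "(a, T) # c \<in> chain_space N deg i D \<longleftrightarrow> T \<in> monomials N deg i D \<and> c \<in> chain_space N deg i D"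
  "c @ d \<in> chain_space N deg i D \<longleftrightarrow> c \<in> chain_space N deg i D \<and> d \<in> chain_space N deg i D"
  "chain_scale m c \<in> chain_space N deg i D \<longleftrightarrow> c \<in> chain_space N deg i D"
  by (auto simp: chain_space_def chain_scale_def image_image case_prod_unfold)

lemma chain_bind_in_chain_space:
  "(\<And>a T. (a, T) \<in> set c \<Longrightarrow> F T \<in> chain_space N deg i D) \<Longrightarrow> chain_bind c F \<in> chain_space N deg i D"
proof (induction c)
  case (Cons p c)
  obtain a T where p: "p = (a, T)" by force
  have "chain_bind c F \<in> chain_space N deg i D"
    by (rule Cons.IH) (use Cons.prems in auto)
  then show ?case using Cons.prems[of a T] by (simp add: p chain_bind_def)
qed (simp add: chain_bind_def)

lemma monomials_Cons:
  "s # T \<in> monomials N deg (Suc i) D \<longleftrightarrow>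
     s < N \<and> (\<forall>t\<in>set T. s < t) \<and> T \<in> monomials N deg i (D - deg s)"
  by (auto simp: monomials_def)

lemma monomials_0: "T \<in> monomials N deg 0 D \<longleftrightarrow> T = [] \<and> D = 0"
  by (auto simp: monomials_def)

lemma finite_monomials: "finite (monomials N deg i D)"
  by (rule finite_subset[OF _ finite_lists_length_eq[of "{..<N}" i]]) (auto simp: monomials_def)

lemma monomials_subseqs:
  assumes "T \<in> monomials N deg i D"
  shows "T \<in> set (subseqs [0..<N])"
proof -
  have T: "sorted_wrt (<) T" "set T \<subseteq> {..<N}" using assms by (auto simp: monomials_def)
  have "T = filter (\<lambda>x. x \<in> set T) [0..<N]"
    using T by (intro sorted_distinct_set_unique) (auto simp: strict_sorted_iff sorted_wrt_filter)
  then show ?thesis using subseq_filter_left[of "\<lambda>x. x \<in> set T" "[0..<N]"] by simp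
qed

lemma sorted_ins_set: "(a, U) \<in> set (sorted_ins s T) \<Longrightarrow> set U = insert s (set T)"
  by (induction T arbitrary: a U) (auto split: if_splits)

lemma sorted_ins_in_chain_space:
  "s < N \<Longrightarrow> T \<in> monomials N deg i D \<Longrightarrow> sorted_ins s T \<in> chain_space N deg (Suc i) (D + deg s)"
proof (induction T arbitrary: i D)
  case Nil
  then show ?case by (auto simp: monomials_def)
next
  case (Cons t T)
  then obtain j where i: "i = Suc j" by (cases i) (auto simp: monomials_def)
  have T: "T \<in> monomials N deg j (D - deg t)" and t: "t < N" "\<forall>u\<in>set T. t < u"
    using Cons.prems by (auto simp: i monomials_Cons)
  from Cons.IH[OF Cons.prems(1) T]
  have IH: "sorted_ins s T \<in> chain_space N deg (Suc j) (D - deg t + deg s)" .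
  consider "s < t" | "s = t" | "t < s" by linarith
  then show ?case
  proof cases
    case 1
    then show ?thesis using Cons.prems t by (auto simp: i monomials_Cons)
  next
    case 3
    have "t # U \<in> monomials N deg (Suc i) (D + deg s)" if "(a, U) \<in> set (sorted_ins s T)" for a U
      using IH that sorted_ins_set[OF that] t 3
      by (force simp: i monomials_Cons chain_space_def algebra_simps)
    with 3 show ?thesis by (auto simp: chain_space_def)
  qed simp
qed

lemma wedge_chain_in_chain_space:
  assumes s: "s < N" and c: "c \<in> chain_space N deg i D"
  shows "wedge_chain s c \<in> chain_space N deg (Suc i) (D + deg s)"
  unfolding wedge_chain_def
proof (rule chain_bind_in_chain_space)
  fix a T assume "(a, T) \<in> set c"
  then show "sorted_ins s T \<in> chain_space N deg (Suc i) (D + deg s)"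
    using c by (intro sorted_ins_in_chain_space[OF s]) (force simp: chain_space_def)
qed

lemma sort_chain_in_chain_space:
  "set S \<subseteq> {..<N} \<Longrightarrow> sort_chain S \<in> chain_space N deg (length S) (sum_list (map deg S))"
proof (induction S)
  case Nil
  show ?case by (simp add: monomials_def)
next
  case (Cons s S)
  then show ?case
    using wedge_chain_in_chain_space[of s N "sort_chain S" deg "length S" "sum_list (map deg S)"]
    by (simp add: add.commute)
qed

definition eval_chain :: "(nat \<Rightarrow> 'a mat) \<Rightarrow> ('a mat list \<Rightarrow> 'a::comm_ring_1) \<Rightarrow> chain \<Rightarrow> 'a" where
  "eval_chain b f c = (\<Sum>(a, T)\<leftarrow>c. of_int a * f (map b T))"

lemma eval_chain_simps [simp]:
  "eval_chain b f [] = 0"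
  "eval_chain b f ((a, T) # c) = of_int a * f (map b T) + eval_chain b f c"
  "eval_chain b f (c @ d) = eval_chain b f c + eval_chain b f d"
  by (simp_all add: eval_chain_def)

lemma eval_chain_scale [simp]: "eval_chain b f (chain_scale m c) = of_int m * eval_chain b f c"
  by (induction c) (auto simp: chain_scale_def algebra_simps)

lemma eval_chain_concat: "eval_chain b f (concat cs) = (\<Sum>c\<leftarrow>cs. eval_chain b f c)"
  by (induction cs) auto

lemma eval_chain_bind: "eval_chain b f (chain_bind c F) = (\<Sum>(a, T)\<leftarrow>c. of_int a * eval_chain b f (F T))"
  by (induction c) (auto simp: chain_bind_def)

lemma eval_chain_add: "eval_chain b (\<lambda>x. f x + h x) c = eval_chain b f c + eval_chain b h c"
  by (induction c) (auto simp: algebra_simps)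

lemma eval_chain_smult: "eval_chain b (\<lambda>x. m * f x) c = m * eval_chain b f c"
  by (induction c) (auto simp: algebra_simps)

lemma eval_chain_eq_0: "(\<And>a T. (a, T) \<in> set c \<Longrightarrow> f (map b T) = 0) \<Longrightarrow> eval_chain b f c = 0"
  by (induction c) force+

lemma eval_chain_map_neg_Cons:
  "eval_chain b f (map (\<lambda>(a, U). (- a, t # U)) c) = - eval_chain b (contract (b t) f) c"
  by (induction c) (auto simp: contract_apply)

lemma sum_list_eq_0: "(\<And>x. x \<in> set xs \<Longrightarrow> F x = 0) \<Longrightarrow> (\<Sum>x\<leftarrow>xs. F x) = (0 :: 'a::comm_monoid_add)"
  by (induction xs) auto

text \<open>Linear combinations are folds, since matrices of unspecified size form no additive monoid type.\<close>

definition matrix_comb :: "nat \<Rightarrow> (nat \<Rightarrow> 'a::field mat) \<Rightarrow> ('a \<times> nat) list \<Rightarrow> 'a mat" where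
  "matrix_comb n b L = foldr (\<lambda>(a, s) y. a \<cdot>\<^sub>m b s + y) L (0\<^sub>m n n)"

text \<open>The wedge product of a linear form with a cochain.\<close>

fun wedge_form :: "'a::field mat set \<Rightarrow> ('a mat \<Rightarrow> 'a) \<Rightarrow> ('a mat list \<Rightarrow> 'a) \<Rightarrow> 'a mat list \<Rightarrow> 'a" where
  "wedge_form g l f [] = 0"
| "wedge_form g l f (x # xs) = (if x \<in> g then l x * f xs - wedge_form g l (contract x f) xs else 0)"

lemma wedge_form_add: "wedge_form g l (\<lambda>xs. f xs + h xs) ys = wedge_form g l f ys + wedge_form g l h ys"
proof (induction ys arbitrary: f h)
  case (Cons y ys)
  show ?case
    using Cons[of "contract y f" "contract y h"] by (simp add: contract_def algebra_simps)
qed simp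

lemma wedge_form_scale: "wedge_form g l (\<lambda>xs. c * f xs) ys = c * wedge_form g l f ys"
proof (induction ys arbitrary: f)
  case (Cons y ys)
  show ?case
    using Cons[of "contract y f"] by (simp add: contract_def algebra_simps)
qed simp

lemma wedge_form_zero: "wedge_form g l (\<lambda>_. 0) = (\<lambda>_. 0)"
  using wedge_form_scale[of g l 0 "\<lambda>_. 0"] by auto

context matrix_lie_algebra
begin

lemma wedge_form_cochain:
  assumes add: "\<And>x y. x \<in> g \<Longrightarrow> y \<in> g \<Longrightarrow> l (x + y) = l x + l y"
    and smult: "\<And>c x. x \<in> g \<Longrightarrow> l (c \<cdot>\<^sub>m x) = c * l x"
  shows "f \<in> cochains g i \<Longrightarrow> wedge_form g l f \<in> cochains g (Suc i)"
proof (induction i arbitrary: f)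
  case (0 f)
  have c: "contract x f = (\<lambda>_. 0)" for x
    using 0 by (simp add: cochains_0_iff contract_def)
  have z: "contract x (wedge_form g l f) xs = (if x \<in> g then l x * f xs else 0)" for x xs
    by (simp add: contract_apply c wedge_form_zero)
  then have z': "wedge_form g l f (x # xs) = (if x \<in> g then l x * f xs else 0)" for x xs
    by (simp add: contract_apply)
  have f0: "f (x # xs) = 0" for x xs using 0 by (simp add: cochains_0_iff)
  show ?case
    unfolding cochains_Suc_iff cochains_0_iff
    using 0 by (auto simp: z z' cochains_0_iff fun_eq_iff add smult add_closed smult_closed
        algebra_simps simp del: wedge_form.simps(2))
next
  case (Suc i f)
  note f = Suc.prems
  have c: "contract x (wedge_form g l f) = (\<lambda>xs. l x * f xs - wedge_form g l (contract x f) xs)" if "x \<in> g" for x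
    using that by (simp add: contract_def)
  show ?case
    unfolding cochains_Suc_iff[of _ "Suc i"]
  proof (intro conjI allI ballI impI)
    show "wedge_form g l f [] = 0" by simp
    show "contract x (wedge_form g l f) = (\<lambda>_. 0)" if "x \<notin> g" for x
      using that by (simp add: contract_def)
    show "contract x (wedge_form g l f) \<in> cochains g (Suc i)" if x: "x \<in> g" for x
      unfolding c[OF x]
      by (intro fun_subspaceD(3,4)[OF cochains_subspace] f Suc.IH contract_cochain[OF f x])
    show "wedge_form g l f ((x + y) # xs) = wedge_form g l f (x # xs) + wedge_form g l f (y # xs)"
      if "x \<in> g" "y \<in> g" for x y xs
      using that by (simp add: add_closed contract_add[OF f] wedge_form_add add algebra_simps)
    show "wedge_form g l f ((a \<cdot>\<^sub>m x) # xs) = a * wedge_form g l f (x # xs)" if "x \<in> g" for x a xs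
      using that by (simp add: smult_closed contract_smult[OF f] wedge_form_scale smult algebra_simps)
    show "wedge_form g l f (x # x # xs) = 0" if "x \<in> g" for x xs
      using that by (simp add: contract_repeat[OF f] wedge_form_zero contract_apply)
  qed
qed

end

section \<open>Forms in coordinates\<close>

text \<open>A homogeneous basis \<open>b\<close> with dual coordinates, degrees \<open>deg\<close> and integral structure constants \<open>br\<close>.\<close>

locale graded_basis = matrix_lie_algebra g n
  for g :: "'a::field mat set" and n :: nat +
  fixes gr :: "int \<Rightarrow> 'a mat set" and b :: "nat \<Rightarrow> 'a mat" and coord :: "nat \<Rightarrow> 'a mat \<Rightarrow> 'a"
    and N :: nat and deg :: "nat \<Rightarrow> int" and br :: "nat \<Rightarrow> nat \<Rightarrow> (int \<times> nat) list"
  assumes gr_subset: "x \<in> gr d \<Longrightarrow> x \<in> g"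
    and basis_homogeneous: "s < N \<Longrightarrow> b s \<in> gr (deg s)"
    and coord_add: "s < N \<Longrightarrow> x \<in> g \<Longrightarrow> y \<in> g \<Longrightarrow> coord s (x + y) = coord s x + coord s y"
    and coord_smult: "s < N \<Longrightarrow> x \<in> g \<Longrightarrow> coord s (c \<cdot>\<^sub>m x) = c * coord s x"
    and coord_basis: "s < N \<Longrightarrow> t < N \<Longrightarrow> coord s (b t) = (if s = t then 1 else 0)"
    and expansion: "x \<in> g \<Longrightarrow> x = matrix_comb n b (map (\<lambda>s. (coord s x, s)) [0..<N])"
    and coord_homogeneous: "x \<in> gr d \<Longrightarrow> s < N \<Longrightarrow> coord s x \<noteq> 0 \<Longrightarrow> deg s = d"
    and bracket_basis: "s < N \<Longrightarrow> t < N \<Longrightarrow>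
      lie_bracket (b s) (b t) = matrix_comb n b (map (\<lambda>(a, u). (of_int a, u)) (br s t))"
    and br_graded: "s < N \<Longrightarrow> t < N \<Longrightarrow> (a, u) \<in> set (br s t) \<Longrightarrow> u < N \<and> deg u = deg s + deg t"
begin

lemma basis_in: "s < N \<Longrightarrow> b s \<in> g"
  using basis_homogeneous gr_subset by blast

lemma cochain_matrix_comb:
  assumes f: "f \<in> cochains g i" and ne: "g \<noteq> {}"
  shows "snd ` set L \<subseteq> {..<N} \<Longrightarrow>
    f (matrix_comb n b L # xs) = (\<Sum>(a, s)\<leftarrow>L. a * f (b s # xs)) \<and> matrix_comb n b L \<in> g"
proof (induction L)
  case Nil
  obtain x where x: "x \<in> g" using ne by auto
  have "0\<^sub>m n n = 0 \<cdot>\<^sub>m x" using carrier[OF x] by (intro eq_matI) auto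
  then show ?case using cochain_smult[OF f x, of 0 xs] smult_closed[OF x, of 0] by (simp add: matrix_comb_def)
next
  case (Cons p L)
  obtain a s where p: "p = (a, s)" by force
  have comb: "matrix_comb n b (p # L) = a \<cdot>\<^sub>m b s + matrix_comb n b L"
    by (simp add: matrix_comb_def p)
  have "s < N" using Cons.prems p by simp
  then show ?case
    using Cons unfolding comb
    by (simp add: p cochain_add[OF f] cochain_smult[OF f] basis_in smult_closed add_closed)
qed

lemma cochain_expansion:
  assumes f: "f \<in> cochains g i" and x: "x \<in> g"
  shows "f (x # xs) = (\<Sum>s\<leftarrow>[0..<N]. coord s x * f (b s # xs))"
proof -
  have "f (matrix_comb n b (map (\<lambda>s. (coord s x, s)) [0..<N]) # xs) =
      (\<Sum>(a, s)\<leftarrow>map (\<lambda>s. (coord s x, s)) [0..<N]. a * f (b s # xs))"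
    using x by (intro conjunct1[OF cochain_matrix_comb[OF f]]) auto
  then show ?thesis unfolding expansion[OF x, symmetric] by (simp add: comp_def)
qed

lemma cochain_bracket_basis:
  assumes f: "f \<in> cochains g i" and s: "s < N" and t: "t < N"
  shows "f (lie_bracket (b s) (b t) # xs) = (\<Sum>(a, u)\<leftarrow>br s t. of_int a * f (b u # xs))"
proof -
  have "f (lie_bracket (b s) (b t) # xs) =
      (\<Sum>(a, u)\<leftarrow>map (\<lambda>(a, u). (of_int a, u)) (br s t). a * f (b u # xs))"
    unfolding bracket_basis[OF s t]
    using br_graded[OF s t] basis_in[OF s]
    by (intro conjunct1[OF cochain_matrix_comb[OF f]]) auto
  then show ?thesis by (simp add: comp_def case_prod_unfold)
qed

lemma eval_chain_sorted_ins:
  "f \<in> cochains g i \<Longrightarrow> s < N \<Longrightarrow> set T \<subseteq> {..<N} \<Longrightarrow> eval_chain b f (sorted_ins s T) = f (b s # map b T)"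
proof (induction T arbitrary: f i)
  case (Cons t T)
  consider "s < t" | "s = t" | "t < s" by linarith
  then show ?case
  proof cases
    case 2
    then show ?thesis using cochain_repeat[OF Cons.prems(1) basis_in] Cons.prems by simp
  next
    case 3
    obtain j where c: "contract (b t) f \<in> cochains g j"
      using contract_cochain_or_zero[OF Cons.prems(1) basis_in[of t]] Cons.prems by auto
    have "eval_chain b f (map (\<lambda>(a, U). (- a, t # U)) (sorted_ins s T)) = - eval_chain b (contract (b t) f) (sorted_ins s T)"
      by (rule eval_chain_map_neg_Cons)
    also have "\<dots> = - f (b t # b s # map b T)"
      using Cons.IH[OF c] Cons.prems contract_apply[of "b t" f "b s # map b T"] by simp
    also have "\<dots> = f (b s # b t # map b T)"
      using cochain_antisym[OF Cons.prems(1) basis_in basis_in, of t s "map b T"] Cons.prems by simp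
    finally show ?thesis using 3 by simp
  qed simp
qed simp

lemma eval_chain_wedge:
  assumes f: "f \<in> cochains g i" and s: "s < N"
    and c: "\<And>a T. (a, T) \<in> set c \<Longrightarrow> set T \<subseteq> {..<N}"
  shows "eval_chain b f (wedge_chain s c) = eval_chain b (contract (b s) f) c"
  unfolding wedge_chain_def eval_chain_bind using c
proof (induction c)
  case (Cons p c)
  obtain a T where p: "p = (a, T)" by force
  have T: "set T \<subseteq> {..<N}" using Cons.prems[of a T] p by simp
  have "(\<Sum>(a, T)\<leftarrow>c. of_int a * eval_chain b f (sorted_ins s T)) = eval_chain b (contract (b s) f) c"
    by (rule Cons.IH) (use Cons.prems in auto)
  then show ?case
    using eval_chain_sorted_ins[OF f s T] contract_apply[of "b s" f "map b T"] by (simp add: p)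
qed simp

lemma chain_space_supp: "c \<in> chain_space N deg i D \<Longrightarrow> (a, T) \<in> set c \<Longrightarrow> T \<in> monomials N deg i D"
  by (force simp: chain_space_def)

lemma monomials_sub: "T \<in> monomials N deg i D \<Longrightarrow> set T \<subseteq> {..<N}"
  by (simp add: monomials_def)

lemma eval_chain_wedge_chain_space:
  assumes f: "f \<in> cochains g i" and s: "s < N" and c: "c \<in> chain_space N deg j D"
  shows "eval_chain b f (wedge_chain s c) = eval_chain b (contract (b s) f) c"
  by (rule eval_chain_wedge[OF f s monomials_sub[OF chain_space_supp[OF c]]])

lemma eval_chain_sort_chain:
  "f \<in> cochains g i \<Longrightarrow> set S \<subseteq> {..<N} \<Longrightarrow> eval_chain b f (sort_chain S) = f (map b S)"
proof (induction S arbitrary: f i)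
  case (Cons s S)
  obtain j where c: "contract (b s) f \<in> cochains g j"
    using contract_cochain_or_zero[OF Cons.prems(1) basis_in[of s]] Cons.prems by auto
  have "eval_chain b f (sort_chain (s # S)) = eval_chain b (contract (b s) f) (sort_chain S)"
    unfolding sort_chain.simps
    using Cons.prems by (intro eval_chain_wedge_chain_space[OF Cons.prems(1) _ sort_chain_in_chain_space]) auto
  with Cons.IH[OF c] Cons.prems contract_apply[of "b s" f "map b S"] show ?case by simp
qed simp

lemma ad_chain_in_chain_space:
  assumes s: "s < N"
  shows "S \<in> monomials N deg i D \<Longrightarrow> ad_chain br s S \<in> chain_space N deg i (D + deg s)"
proof (induction S arbitrary: i D)
  case (Cons t S)
  then obtain j where i: "i = Suc j" by (cases i) (auto simp: monomials_def)
  have S: "S \<in> monomials N deg j (D - deg t)" and t: "t < N"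
    using Cons.prems by (auto simp: i monomials_Cons)
  have 1: "wedge_chain t (ad_chain br s S) \<in> chain_space N deg i (D + deg s)"
    using wedge_chain_in_chain_space[OF t Cons.IH[OF S]] by (simp add: i algebra_simps)
  have "sorted_ins u S \<in> chain_space N deg i (D + deg s)" if "(a, u) \<in> set (br s t)" for a u
    using sorted_ins_in_chain_space[OF _ S, of u] br_graded[OF s t that] by (simp add: i algebra_simps)
  then have "concat (map (\<lambda>(a, u). chain_scale a (sorted_ins u S)) L) \<in> chain_space N deg i (D + deg s)"
    if "set L \<subseteq> set (br s t)" for L
    using that by (induction L) auto
  with 1 show ?case by simp
qed simp

lemma boundary_in_chain_space: "S \<in> monomials N deg (Suc i) D \<Longrightarrow> boundary br S \<in> chain_space N deg i D"
proof (induction S arbitrary: i D)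
  case (Cons s S)
  have s: "s < N" and S: "S \<in> monomials N deg i (D - deg s)"
    using Cons.prems by (auto simp: monomials_Cons)
  have "wedge_chain s (boundary br S) \<in> chain_space N deg i D"
  proof (cases i)
    case 0
    then have "S = []" using S by (simp add: monomials_0)
    then show ?thesis by (simp add: wedge_chain_def chain_bind_def)
  next
    case (Suc j)
    then show ?thesis using wedge_chain_in_chain_space[OF s Cons.IH[of j "D - deg s"]] S by simp
  qed
  with ad_chain_in_chain_space[OF s S] show ?case by simp
qed simp

lemma lie_deriv_basis:
  assumes s: "s < N"
  shows "f \<in> cochains g i \<Longrightarrow> S \<in> monomials N deg j D \<Longrightarrow>
    lie_deriv g (b s) f (map b S) = eval_chain b f (ad_chain br s S)"
proof (induction S arbitrary: f i j D)
  case (Cons t S)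
  note f = Cons.prems(1)
  obtain m where j: "j = Suc m" using Cons.prems by (cases j) (auto simp: monomials_def)
  have S: "S \<in> monomials N deg m (D - deg t)" and t: "t < N"
    using Cons.prems by (auto simp: j monomials_Cons)
  obtain l where c: "contract (b t) f \<in> cochains g l"
    using contract_cochain_or_zero[OF f basis_in[OF t]] by auto
  have "eval_chain b f (concat (map (\<lambda>(a, u). chain_scale a (sorted_ins u S)) L)) =
      (\<Sum>(a, u)\<leftarrow>L. of_int a * f (b u # map b S))" if "set L \<subseteq> set (br s t)" for L
    using that
  proof (induction L)
    case (Cons p L)
    obtain a u where p: "p = (a, u)" by force
    have "u < N" using br_graded[OF s t, of a u] Cons.prems p by simp
    then show ?case using Cons eval_chain_sorted_ins[OF f _ monomials_sub[OF S]] by (simp add: p)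
  qed simp
  then show ?case
    using Cons.IH[OF c S] cochain_bracket_basis[OF f s t] basis_in[OF t]
      eval_chain_wedge_chain_space[OF f t ad_chain_in_chain_space[OF s S]] by simp
qed simp

text \<open>The differential is the transpose of the boundary operator.\<close>

lemma ce_diff_basis:
  "f \<in> cochains g i \<Longrightarrow> S \<in> monomials N deg (Suc i) D \<Longrightarrow>
    ce_diff g i f (map b S) = eval_chain b f (boundary br S)"
proof (induction i arbitrary: f S D)
  case 0
  then obtain s where "S = [s]" by (auto simp: monomials_def length_Suc_conv)
  then show ?case by (simp add: ce_diff_0 wedge_chain_def chain_bind_def)
next
  case (Suc i)
  note f = Suc.prems(1)
  from Suc.prems(2) obtain s S' where S: "S = s # S'"
    by (auto simp: monomials_def length_Suc_conv)
  have s: "s < N" and S': "S' \<in> monomials N deg (Suc i) (D - deg s)"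
    using Suc.prems(2) by (auto simp: S monomials_Cons)
  have "ce_diff g (Suc i) f (map b S) =
      lie_deriv g (b s) f (map b S') - ce_diff g i (contract (b s) f) (map b S')"
    using contract_ce_diff[OF f basis_in[OF s]] by (simp add: S fun_eq_iff contract_apply)
  then show ?case
    using Suc.IH[OF contract_cochain[OF f basis_in[OF s]] S'] lie_deriv_basis[OF s f S']
      eval_chain_wedge_chain_space[OF f s boundary_in_chain_space[OF S']] by (simp add: S)
qed

text \<open>Expanding a homogeneous argument in the basis only involves basis vectors of the same degree, so the
total degree \<open>D\<close> is preserved.\<close>

lemma cochain_zero_homogeneous:
  "f \<in> cochains g i \<Longrightarrow>
   (\<And>S. set S \<subseteq> {..<N} \<Longrightarrow> length S = i \<Longrightarrow> sum_list (map deg S) = D \<Longrightarrow> f (map b S) = 0) \<Longrightarrow>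
   list_all2 (\<lambda>x d. x \<in> gr d) xs ds \<Longrightarrow> sum_list ds = D \<Longrightarrow> f xs = 0"
proof (induction i arbitrary: f xs ds D)
  case 0
  show ?case
  proof (cases xs)
    case Nil
    then show ?thesis using 0(2)[of "[]"] 0(3,4) by simp
  qed (use 0(1) in \<open>simp add: cochains_0_iff\<close>)
next
  case (Suc i)
  show ?case
  proof (cases xs)
    case Nil
    then show ?thesis using cochain_Nil[OF Suc.prems(1)] by simp
  next
    case (Cons x ys)
    then obtain d es where ds: "ds = d # es" "x \<in> gr d" "list_all2 (\<lambda>x d. x \<in> gr d) ys es"
      using Suc.prems(3) by (auto simp: list_all2_Cons1)
    have "coord s x * f (b s # ys) = 0" if s: "s < N" for s
    proof (cases "coord s x = 0")
      case False
      then have d: "deg s = d" using coord_homogeneous[OF ds(2) s] by simp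
      have "contract (b s) f ys = 0"
      proof (rule Suc.IH[OF contract_cochain[OF Suc.prems(1) basis_in[OF s]] _ ds(3) refl])
        fix S assume "set S \<subseteq> {..<N}" "length S = i" "sum_list (map deg S) = sum_list es"
        then show "contract (b s) f (map b S) = 0"
          using Suc.prems(2)[of "s # S"] s d ds(1) Suc.prems(4) by (simp add: contract_apply)
      qed
      then show ?thesis by (simp add: contract_apply)
    qed simp
    then have "(\<Sum>s\<leftarrow>[0..<N]. coord s x * f (b s # ys)) = 0"
      by (intro sum_list_eq_0) auto
    then show ?thesis
      using cochain_expansion[OF Suc.prems(1) gr_subset[OF ds(2)], of ys] Cons by simp
  qed
qed

lemma cochain_zero:
  "f \<in> cochains g i \<Longrightarrow>
   (\<And>S. set S \<subseteq> {..<N} \<Longrightarrow> length S = i \<Longrightarrow> f (map b S) = 0) \<Longrightarrow> f xs = 0"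
proof (induction i arbitrary: f xs)
  case 0
  then show ?case using 0(2)[of "[]"] by (cases xs) (simp_all add: cochains_0_iff)
next
  case (Suc i)
  show ?case
  proof (cases xs)
    case Nil
    then show ?thesis using cochain_Nil[OF Suc.prems(1)] by simp
  next
    case (Cons x ys)
    show ?thesis
    proof (cases "x \<in> g")
      case True
      have "f (b s # ys) = 0" if s: "s < N" for s
      proof -
        have "contract (b s) f ys = 0"
        proof (rule Suc.IH[OF contract_cochain[OF Suc.prems(1) basis_in[OF s]]])
          fix S assume "set S \<subseteq> {..<N}" "length S = i"
          then show "contract (b s) f (map b S) = 0"
            using Suc.prems(2)[of "s # S"] s by (simp add: contract_apply)
        qed
        then show ?thesis by (simp add: contract_apply)
      qed
      then have "(\<Sum>s\<leftarrow>[0..<N]. coord s x * f (b s # ys)) = 0"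
        by (intro sum_list_eq_0) auto
      then show ?thesis using cochain_expansion[OF Suc.prems(1) True, of ys] Cons by simp
    qed (use cochain_notin[OF Suc.prems(1)] Cons in simp)
  qed
qed

lemma cochain_zero_unsorted:
  assumes f: "f \<in> cochains g i" and S: "set S \<subseteq> {..<N}" "length S = i"
    and z: "\<And>T. T \<in> monomials N deg i (sum_list (map deg S)) \<Longrightarrow> f (map b T) = 0"
  shows "f (map b S) = 0"
  using eval_chain_sort_chain[OF f S(1)] eval_chain_eq_0[of "sort_chain S" f b] z
    chain_space_supp[OF sort_chain_in_chain_space[OF S(1)]] S(2) by metis

lemma cochain_eqI:
  assumes f: "f \<in> cochains g i" and h: "h \<in> cochains g i"
    and eq: "\<And>D T. T \<in> monomials N deg i D \<Longrightarrow> f (map b T) = h (map b T)"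
  shows "f = h"
proof
  fix xs
  have d: "(\<lambda>xs. f xs - h xs) \<in> cochains g i"
    by (rule fun_subspaceD(4)[OF cochains_subspace f h])
  have "(\<lambda>xs. f xs - h xs) xs = 0"
    by (rule cochain_zero[OF d], rule cochain_zero_unsorted[OF d]) (auto simp: eq)
  then show "f xs = h xs" by simp
qed

lemma graded_cochainsI:
  assumes f: "f \<in> cochains g i"
    and z: "\<And>D T. D \<noteq> - k \<Longrightarrow> T \<in> monomials N deg i D \<Longrightarrow> f (map b T) = 0"
  shows "f \<in> graded_cochains g gr i k"
  unfolding graded_cochains_def
proof (intro CollectI conjI allI impI f, elim conjE)
  fix xs ds assume *: "length xs = i" "length ds = i" "\<forall>p<i. xs ! p \<in> gr (ds ! p)"
    "sum_list ds \<noteq> - k"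
  show "f xs = 0"
  proof (rule cochain_zero_homogeneous[OF f _ _ refl])
    show "list_all2 (\<lambda>x d. x \<in> gr d) xs ds" using * by (simp add: list_all2_conv_all_nth)
    show "f (map b S) = 0"
      if "set S \<subseteq> {..<N}" "length S = i" "sum_list (map deg S) = sum_list ds" for S
      by (rule cochain_zero_unsorted[OF f that(1,2)]) (use that(3) * z in simp)
  qed
qed

lemma graded_cochainsD:
  assumes f: "f \<in> graded_cochains g gr i k" and T: "T \<in> monomials N deg i D" and D: "D \<noteq> - k"
  shows "f (map b T) = 0"
proof -
  have "length (map b T) = i \<and> length (map deg T) = i \<and>
      (\<forall>p<i. map b T ! p \<in> gr (map deg T ! p)) \<and> sum_list (map deg T) \<noteq> - k"
    using T D basis_homogeneous by (auto simp: monomials_def subset_iff)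
  then show ?thesis using f unfolding graded_cochains_def by blast
qed

text \<open>Products of coordinate forms; on increasing monomials they are the dual basis.\<close>

fun dual_form :: "nat list \<Rightarrow> 'a mat list \<Rightarrow> 'a" where
  "dual_form [] = (\<lambda>xs. if xs = [] then 1 else 0)"
| "dual_form (s # S) = wedge_form g (coord s) (dual_form S)"

lemma dual_form_cochain: "set S \<subseteq> {..<N} \<Longrightarrow> dual_form S \<in> cochains g (length S)"
  by (induction S) (auto simp: cochains_0_iff intro!: wedge_form_cochain coord_add coord_smult)

lemma contract_dual_form: "t < N \<Longrightarrow> set S \<subseteq> {..<N} - {t} \<Longrightarrow> contract (b t) (dual_form S) = (\<lambda>_. 0)"
proof (induction S)
  case (Cons s S)
  then have "contract (b t) (dual_form S) = (\<lambda>_. 0)" by simp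
  with Cons.prems show ?case
    by (auto simp: contract_def[of _ "wedge_form _ _ _"] basis_in coord_basis wedge_form_zero)
qed (simp add: contract_def)

lemma wedge_form_coord_zero: "s < N \<Longrightarrow> set T \<subseteq> {..<N} - {s} \<Longrightarrow> wedge_form g (coord s) f (map b T) = 0"
  by (induction T arbitrary: f) (auto simp: basis_in coord_basis)

text \<open>If the first indices agree, the contraction term vanishes because that index does not recur. If they
differ, the smaller one is missing from the other list, which kills the value from the left or from
the right.\<close>

lemma dual_form_basis:
  "sorted_wrt (<) S \<Longrightarrow> set S \<subseteq> {..<N} \<Longrightarrow> sorted_wrt (<) T \<Longrightarrow> set T \<subseteq> {..<N} \<Longrightarrow>
    dual_form S (map b T) = (if S = T then 1 else 0)"
proof (induction S arbitrary: T)
  case (Cons s S)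
  show ?case
  proof (cases T)
    case (Cons t T')
    consider "s = t" | "s \<notin> set T" | "s \<noteq> t" "s \<in> set T" by blast
    then show ?thesis
    proof cases
      case 1
      have "set S \<subseteq> {..<N} - {t}" using Cons.prems 1 by force
      moreover have t: "t < N" using Cons.prems \<open>T = t # T'\<close> by simp
      ultimately have "contract (b t) (dual_form S) = (\<lambda>_. 0)" by (intro contract_dual_form)
      then have "dual_form (s # S) (map b T) = dual_form S (map b T')"
        using 1 t \<open>T = t # T'\<close> by (simp add: basis_in coord_basis wedge_form_zero)
      moreover have "dual_form S (map b T') = (if S = T' then 1 else 0)"
        using Cons.prems \<open>T = t # T'\<close> by (intro Cons.IH) auto
      ultimately show ?thesis using 1 \<open>T = t # T'\<close> by simp
    next
      case 2
      then show ?thesis using Cons.prems wedge_form_coord_zero[of s T "dual_form S"] by auto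
    next
      case 3
      then have "t < s" using Cons.prems \<open>T = t # T'\<close> by auto
      then have "set (s # S) \<subseteq> {..<N} - {t}" using Cons.prems by force
      then have "contract (b t) (dual_form (s # S)) (map b T') = 0"
        using contract_dual_form[of t "s # S"] Cons.prems \<open>T = t # T'\<close> by simp
      then show ?thesis using 3 \<open>T = t # T'\<close> by (simp add: contract_apply del: dual_form.simps)
    qed
  qed simp
qed simp

definition cochain_with_values :: "nat \<Rightarrow> int \<Rightarrow> (nat list \<Rightarrow> 'a) \<Rightarrow> 'a mat list \<Rightarrow> 'a" where
  "cochain_with_values i k c = (\<lambda>xs. \<Sum>T\<in>monomials N deg i (- k). c T * dual_form T xs)"

lemma cochain_with_values_cochain: "cochain_with_values i k c \<in> cochains g i"
  unfolding cochain_with_values_def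
proof (intro fun_subspace_sum[OF cochains_subspace] fun_subspaceD(3)[OF cochains_subspace])
  fix T assume "T \<in> monomials N deg i (- k)"
  then show "dual_form T \<in> cochains g i" using dual_form_cochain[of T] by (simp add: monomials_def)
qed

lemma cochain_with_values_basis:
  assumes T: "T \<in> monomials N deg i D"
  shows "cochain_with_values i k c (map b T) = (if D = - k then c T else 0)"
proof -
  have "cochain_with_values i k c (map b T) = (\<Sum>S\<in>monomials N deg i (- k). if S = T then c S else 0)"
    unfolding cochain_with_values_def
    using T by (intro sum.cong refl) (auto simp: monomials_def dual_form_basis)
  also have "\<dots> = (if T \<in> monomials N deg i (- k) then c T else 0)"
    by (simp add: sum.delta finite_monomials)
  also have "T \<in> monomials N deg i (- k) \<longleftrightarrow> D = - k"
    using T by (auto simp: monomials_def)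
  finally show ?thesis .
qed

lemma cochain_with_values_graded: "cochain_with_values i k c \<in> graded_cochains g gr i k"
  by (rule graded_cochainsI[OF cochain_with_values_cochain]) (simp add: cochain_with_values_basis)

end

section \<open>Homotopies on chains\<close>

text \<open>Adding a term to a chain whose coefficients are reduced modulo \<open>p\<close>. A chain that reduces to the empty
list is zero in characteristic \<open>p\<close>.\<close>

fun add_term :: "int \<Rightarrow> int \<times> nat list \<Rightarrow> chain \<Rightarrow> chain" where
  "add_term p (a, T) [] = (if a mod p = 0 then [] else [(a, T)])"
| "add_term p (a, T) ((a', U) # c) =
     (if T = U then if (a + a') mod p = 0 then c else ((a + a') mod p, U) # c
      else (a', U) # add_term p (a, T) c)"

definition vanishes :: "int \<Rightarrow> chain \<Rightarrow> bool" where
  "vanishes p c \<longleftrightarrow> foldr (add_term p) c [] = []"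

definition int_eval :: "chain \<Rightarrow> chain \<Rightarrow> int" where
  "int_eval z c = (\<Sum>(a, T)\<leftarrow>c. a * coef z T)"

lemma of_int_mod:
  assumes "of_int p = (0 :: 'a::comm_ring_1)"
  shows "(of_int (a mod p) :: 'a) = of_int a"
proof -
  have "(of_int a :: 'a) = of_int (p * (a div p) + a mod p)" by simp
  also have "\<dots> = of_int (a mod p)" using assms by (simp only: of_int_add of_int_mult) simp
  finally show ?thesis by simp
qed

lemma of_int_eq_0_mod:
  "of_int p = (0 :: 'a::comm_ring_1) \<Longrightarrow> a mod p = 0 \<Longrightarrow> of_int a = (0 :: 'a)"
  using of_int_mod[of p a] by simp

lemma eval_chain_add_term:
  assumes p: "of_int p = (0 :: 'a::comm_ring_1)"
  shows "eval_chain b f (add_term p (a, T) c) = of_int a * (f (map b T) :: 'a) + eval_chain b f c"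
proof (induction c)
  case Nil
  show ?case using of_int_eq_0_mod[OF p, of a] by simp
next
  case (Cons q c)
  obtain a' U where q: "q = (a', U)" by force
  have m: "of_int ((a + a') mod p) = (of_int a + of_int a' :: 'a)"
    by (simp add: of_int_mod[OF p])
  show ?case
  proof (cases "(a + a') mod p = 0")
    case True
    with m have "of_int a * f (map b U) + of_int a' * f (map b U) = 0"
      by (simp flip: distrib_right)
    with True Cons q show ?thesis by (simp flip: add.assoc)
  next
    case False
    with m Cons q show ?thesis by (simp add: algebra_simps)
  qed
qed

lemma eval_chain_vanishes:
  assumes p: "of_int p = (0 :: 'a::comm_ring_1)" and c: "vanishes p c"
  shows "eval_chain b f c = (0 :: 'a)"
proof -
  have "eval_chain b f (foldr (add_term p) c []) = eval_chain b f c"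
    by (induction c) (auto simp: eval_chain_add_term[OF p])
  with c show ?thesis by (simp add: vanishes_def)
qed

context graded_basis
begin

text \<open>A chain read as the form that has its coefficients as values on monomials of degree \<open>-k\<close>, the degree
of the arguments on which forms of degree \<open>k\<close> live.\<close>

definition int_cochain :: "nat \<Rightarrow> int \<Rightarrow> chain \<Rightarrow> 'a mat list \<Rightarrow> 'a" where
  "int_cochain i k z = cochain_with_values i k (\<lambda>T. of_int (coef z T))"

lemma eval_chain_int_cochain:
  assumes "c \<in> chain_space N deg i (- k)"
  shows "eval_chain b (int_cochain i k z) c = of_int (int_eval z c)"
  using assms
proof (induction c)
  case (Cons q c)
  obtain a T where q: "q = (a, T)" by force
  with Cons show ?case
    by (simp add: int_cochain_def cochain_with_values_basis[of T i "- k"] int_eval_def)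
qed (simp add: int_eval_def)

lemma eval_chain_boundary:
  assumes h: "h \<in> cochains g i" and c: "c \<in> chain_space N deg (Suc i) D"
  shows "eval_chain b (ce_diff g i h) c = eval_chain b h (chain_bind c (boundary br))"
  using c
proof (induction c)
  case (Cons q c)
  obtain a T where q: "q = (a, T)" by force
  with Cons show ?case
    by (simp add: eval_chain_bind ce_diff_basis[OF h, of T D])
qed (simp add: eval_chain_bind)

lemma ce_diff_cochain_with_values:
  assumes S: "S \<in> monomials N deg (Suc i) D"
  shows "ce_diff g i (cochain_with_values i k (\<lambda>T. eval_chain b f (H T))) (map b S) =
    (if D = - k then eval_chain b f (chain_bind (boundary br S) H) else 0)"
proof -
  have "ce_diff g i (cochain_with_values i k (\<lambda>T. eval_chain b f (H T))) (map b S) =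
      eval_chain b (cochain_with_values i k (\<lambda>T. eval_chain b f (H T))) (boundary br S)"
    by (rule ce_diff_basis[OF cochain_with_values_cochain S])
  also have "\<dots> = (\<Sum>(a, T)\<leftarrow>boundary br S. of_int a * (if D = - k then eval_chain b f (H T) else 0))"
    unfolding eval_chain_def[of b "cochain_with_values _ _ _"]
  proof (intro arg_cong[of _ _ sum_list] map_cong refl)
    fix q assume q: "q \<in> set (boundary br S)"
    obtain a T where "q = (a, T)" by force
    with q cochain_with_values_basis[OF chain_space_supp[OF boundary_in_chain_space[OF S]], of a T k]
    show "(case q of (a, T) \<Rightarrow> of_int a * cochain_with_values i k (\<lambda>T. eval_chain b f (H T)) (map b T)) =
        (case q of (a, T) \<Rightarrow> of_int a * (if D = - k then eval_chain b f (H T) else 0))" by simp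
  qed
  also have "\<dots> = (if D = - k then eval_chain b f (chain_bind (boundary br S) H) else 0)"
    by (auto simp: eval_chain_bind intro!: sum_list_eq_0)
  finally show ?thesis .
qed

text \<open>A contraction of the degree \<open>k\<close> part onto its homology in exterior power \<open>i\<close>, modulo \<open>p\<close>: the map
\<open>S \<mapsto> \<Sum> z(S) \<phi>\<close> over the pairs in \<open>R\<close> is a projection onto the span of the cycles, and \<open>H\<close> is a
homotopy between it and the identity.\<close>

context
  fixes p :: int and i :: nat and k :: int and H :: "nat list \<Rightarrow> chain" and R :: "(chain \<times> chain) list"
  assumes p: "of_int p = (0 :: 'a)"
    and H_chain: "\<And>S. S \<in> monomials N deg i (- k) \<Longrightarrow> H S \<in> chain_space N deg (Suc i) (- k)"
    and cycle: "\<And>\<phi> z. (\<phi>, z) \<in> set R \<Longrightarrow>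
      \<phi> \<in> chain_space N deg i (- k) \<and> vanishes p (chain_bind \<phi> (boundary br))"
    and cocycle: "\<And>S \<phi> z. S \<in> monomials N deg (Suc i) (- k) \<Longrightarrow> (\<phi>, z) \<in> set R \<Longrightarrow>
      int_eval z (boundary br S) mod p = 0"
    and dual: "\<And>j l. j < length R \<Longrightarrow> l < length R \<Longrightarrow>
      (int_eval (snd (R ! l)) (fst (R ! j)) - (if j = l then 1 else 0)) mod p = 0"
    and homotopy: "\<And>S. S \<in> monomials N deg i (- k) \<Longrightarrow>
      vanishes p (chain_bind (boundary br S) H @ chain_bind (H S) (boundary br) @
        concat (map (\<lambda>(\<phi>, z). chain_scale (coef z S) \<phi>) R) @ [(-1, S)])"
begin

lemma int_cochain_cocycle:
  assumes "(\<phi>, z) \<in> set R"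
  shows "int_cochain i k z \<in> cocycles g i \<inter> graded_cochains g gr i k"
proof -
  have z: "int_cochain i k z \<in> cochains g i"
    unfolding int_cochain_def by (rule cochain_with_values_cochain)
  have "ce_diff g i (int_cochain i k z) = (\<lambda>_. 0)"
  proof (rule cochain_eqI[OF ce_diff_cochain[OF z] fun_subspaceD(1)[OF cochains_subspace]])
    fix D S assume S: "S \<in> monomials N deg (Suc i) D"
    have "eval_chain b (int_cochain i k z) (boundary br S) = 0"
    proof (cases "D = - k")
      case True
      with boundary_in_chain_space[OF S] cocycle[OF _ assms, of S] S show ?thesis
        by (simp add: eval_chain_int_cochain of_int_eq_0_mod[OF p])
    next
      case False
      then show ?thesis
        unfolding int_cochain_def
        by (intro eval_chain_eq_0) (simp add: cochain_with_values_basis[OF chain_space_supp[OF boundary_in_chain_space[OF S]]])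
    qed
    then show "ce_diff g i (int_cochain i k z) (map b S) = 0"
      by (simp add: ce_diff_basis[OF z S])
  qed
  with z show ?thesis
    using cochain_with_values_graded by (simp add: cocycles_def int_cochain_def)
qed

text \<open>The identity \<open>homotopy\<close> evaluated by \<open>f\<close>; the term \<open>\<partial>(H S)\<close> drops out since \<open>f\<close> is a cocycle.\<close>

lemma homotopy_formula:
  assumes f: "f \<in> cochains g i" and df: "ce_diff g i f = (\<lambda>_. 0)"
    and S: "S \<in> monomials N deg i (- k)"
  shows "f (map b S) = eval_chain b f (chain_bind (boundary br S) H) +
    (\<Sum>j<length R. eval_chain b f (fst (R ! j)) * int_cochain i k (snd (R ! j)) (map b S))"
proof -
  have "eval_chain b f (chain_bind (H S) (boundary br)) = 0"
    using eval_chain_boundary[OF f H_chain[OF S]] by (simp add: df eval_chain_eq_0)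
  moreover have "eval_chain b f (concat (map (\<lambda>(\<phi>, z). chain_scale (coef z S) \<phi>) R)) =
      (\<Sum>(\<phi>, z)\<leftarrow>R. eval_chain b f \<phi> * int_cochain i k z (map b S))"
    using S by (simp add: eval_chain_concat comp_def case_prod_unfold int_cochain_def cochain_with_values_basis
        mult.commute)
  moreover have "\<dots> = (\<Sum>j<length R. eval_chain b f (fst (R ! j)) * int_cochain i k (snd (R ! j)) (map b S))"
    by (simp add: sum_list_sum_nth case_prod_unfold atLeast0LessThan)
  ultimately show ?thesis
    using eval_chain_vanishes[OF p homotopy[OF S], of b f] by (simp add: algebra_simps)
qed

text \<open>The first summand of the preceding formula is the differential of the form \<open>T \<mapsto> f (H T)\<close>.\<close>

lemma cocycle_decomposition:
  assumes f: "f \<in> cocycles g i \<inter> graded_cochains g gr i k"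
  shows "(\<lambda>x. f x - (\<Sum>j<length R. eval_chain b f (fst (R ! j)) * int_cochain i k (snd (R ! j)) x))
    \<in> coboundaries g i" (is "?d \<in> _")
proof -
  have fc: "f \<in> cochains g i" and df: "ce_diff g i f = (\<lambda>_. 0)" and fg: "f \<in> graded_cochains g gr i k"
    using f by (auto simp: cocycles_def)
  have "(\<lambda>x. \<Sum>j<length R. eval_chain b f (fst (R ! j)) * int_cochain i k (snd (R ! j)) x) \<in> graded_cochains g gr i k"
    unfolding int_cochain_def
    by (intro fun_subspace_sum[OF graded_cochains_subspace]
        fun_subspaceD(3)[OF graded_cochains_subspace] cochain_with_values_graded)
  then have dg: "?d \<in> graded_cochains g gr i k"
    by (intro fun_subspaceD(4)[OF graded_cochains_subspace] fg)
  then have dc: "?d \<in> cochains g i" by (simp add: graded_cochains_def)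
  show ?thesis
  proof (cases i)
    case 0
    have "?d = (\<lambda>_. 0)"
    proof (rule cochain_eqI[OF dc fun_subspaceD(1)[OF cochains_subspace]])
      fix D S assume S: "S \<in> monomials N deg i D"
      then have S0: "S = []" using 0 by (simp add: monomials_0)
      show "?d (map b S) = 0"
      proof (cases "D = - k")
        case True
        with homotopy_formula[OF fc df, of S] S show ?thesis by (simp add: S0 chain_bind_def)
      qed (rule graded_cochainsD[OF dg S])
    qed
    then show ?thesis by (simp add: 0 coboundaries_0)
  next
    case (Suc m)
    \<comment> \<open>The transpose of \<open>H\<close> applied to \<open>f\<close>.\<close>
    let ?e = "cochain_with_values m k (\<lambda>T. eval_chain b f (H T))"
    have "?d = ce_diff g m ?e"
    proof (rule cochain_eqI[OF dc])
      show "ce_diff g m ?e \<in> cochains g i" unfolding Suc by (rule ce_diff_cochain[OF cochain_with_values_cochain])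
      fix D S assume S: "S \<in> monomials N deg i D"
      show "?d (map b S) = ce_diff g m ?e (map b S)"
      proof (cases "D = - k")
        case True
        with homotopy_formula[OF fc df, of S] S ce_diff_cochain_with_values[of S m D k f H]
        show ?thesis by (simp add: Suc)
      next
        case False
        with graded_cochainsD[OF dg S False] ce_diff_cochain_with_values[of S m D k f H] S
        show ?thesis by (simp add: Suc)
      qed
    qed
    then show ?thesis using cochain_with_values_cochain by (auto simp: Suc coboundaries_Suc)
  qed
qed

lemma cocycles_graded_subspace: "fun_subspace (cocycles g i \<inter> graded_cochains g gr i k)"
  by (intro fun_subspace_Int cocycles_subspace graded_cochains_subspace)

lemma has_dim_by_homotopy: "has_dim (graded_cohomology g gr i k) (length R)"
proof (rule graded_cohomology_has_dim[OF coboundaries_subspace cocycles_graded_subspace])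
  fix j assume j: "j < length R"
  obtain \<phi> z where R: "R ! j = (\<phi>, z)" by force
  with j have mem: "(\<phi>, z) \<in> set R" by (metis nth_mem)
  show "int_cochain i k (snd (R ! j)) \<in> cocycles g i \<inter> graded_cochains g gr i k"
    using int_cochain_cocycle[OF mem] R by simp
  show "eval_chain b f (fst (R ! j)) = 0" if f: "f \<in> coboundaries g i" for f
  proof (cases i)
    case 0
    then show ?thesis using f by (simp add: coboundaries_0 eval_chain_eq_0)
  next
    case (Suc m)
    then obtain h where h: "h \<in> cochains g m" "f = ce_diff g m h"
      using f by (auto simp: coboundaries_Suc)
    then show ?thesis
      using eval_chain_boundary[OF h(1), of \<phi> "- k"] cycle[OF mem] eval_chain_vanishes[OF p] Suc R by simp
  qed
  fix l assume l: "l < length R"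
  have "R ! j \<in> set R" using j by simp
  then have "fst (R ! j) \<in> chain_space N deg i (- k)"
    using cycle[of "fst (R ! j)" "snd (R ! j)"] by simp
  then show "eval_chain b (int_cochain i k (snd (R ! l))) (fst (R ! j)) = (if j = l then 1 else 0)"
    using of_int_eq_0_mod[OF p dual[OF j l]] by (simp add: eval_chain_int_cochain split: if_splits)
qed (use cocycle_decomposition in \<open>auto simp: eval_chain_add eval_chain_smult\<close>)

lemma trivial_by_homotopy:
  assumes "R = []"
  shows "carrier (graded_cohomology g gr i k) = {\<zero>\<^bsub>graded_cohomology g gr i k\<^esub>}"
  by (rule graded_cohomology_trivial[OF coboundaries_subspace cocycles_graded_subspace])
    (use cocycle_decomposition in \<open>auto simp: assms\<close>)

end

lemma lie_deriv_weight:
  assumes h: "h \<in> g" and w: "\<And>s. s < N \<Longrightarrow> lie_bracket h (b s) = w s \<cdot>\<^sub>m b s"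
  shows "f \<in> cochains g i \<Longrightarrow> set S \<subseteq> {..<N} \<Longrightarrow> length S = i \<Longrightarrow>
    lie_deriv g h f (map b S) = - (\<Sum>s\<leftarrow>S. w s) * f (map b S)"
proof (induction S arbitrary: f i)
  case (Cons s S)
  obtain j where i: "i = Suc j" using Cons.prems by (cases i) auto
  have s: "s < N" using Cons.prems by simp
  have f: "f \<in> cochains g (Suc j)" using Cons.prems i by simp
  show ?case
    using Cons.IH[OF contract_cochain[OF f basis_in[OF s]]] Cons.prems i
      cochain_smult[OF f basis_in[OF s]] w[OF s] basis_in[OF s]
      contract_apply[of "b s" f "map b S"]
    by (simp add: algebra_simps)
qed simp

text \<open>Here \<open>h\<close> acts on basis vectors by minus their degree, so \<open>L\<^sub>h f = -k f\<close> for a form of degree \<open>k\<close>, and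
Cartan's formula makes a cocycle \<open>f\<close> the differential of \<open>-\<iota>\<^sub>h f / k\<close>.\<close>

lemma trivial_by_weight:
  assumes h: "h \<in> g"
    and w: "\<And>s. s < N \<Longrightarrow> lie_bracket h (b s) = of_int (- deg s) \<cdot>\<^sub>m b s"
    and k: "of_int k \<noteq> (0 :: 'a)"
  shows "carrier (graded_cohomology g gr i k) = {\<zero>\<^bsub>graded_cohomology g gr i k\<^esub>}"
proof (rule graded_cohomology_trivial[OF coboundaries_subspace])
  show "fun_subspace (cocycles g i \<inter> graded_cochains g gr i k)"
    by (intro fun_subspace_Int cocycles_subspace graded_cochains_subspace)
  show "cocycles g i \<inter> graded_cochains g gr i k \<subseteq> coboundaries g i"
  proof
    fix f assume "f \<in> cocycles g i \<inter> graded_cochains g gr i k"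
    then have f: "f \<in> cochains g i" and df: "ce_diff g i f = (\<lambda>_. 0)"
      and fg: "f \<in> graded_cochains g gr i k"
      by (auto simp: cocycles_def)
    have "lie_deriv g h f = (\<lambda>x. - of_int k * f x)"
    proof (rule cochain_eqI[OF lie_deriv_cochain[OF h f] fun_subspaceD(3)[OF cochains_subspace f]])
      fix D S assume S: "S \<in> monomials N deg i D"
      have "- (\<Sum>s\<leftarrow>S. of_int (- deg s)) = (of_int (sum_list (map deg S)) :: 'a)"
        by (induction S) auto
      also have "\<dots> = of_int D" using S by (simp add: monomials_def)
      finally have "lie_deriv g h f (map b S) = of_int D * f (map b S)"
        using lie_deriv_weight[OF h w f, of S] S by (simp add: monomials_def)
      then show "lie_deriv g h f (map b S) = - of_int k * f (map b S)"
        using graded_cochainsD[OF fg S] by (cases "D = - k") auto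
    qed
    moreover have "ce_diff g (Suc m) f = (\<lambda>_. 0)" if "i = Suc m" for m
      using df that by simp
    ultimately show "f \<in> coboundaries g i"
    proof (cases i)
      case 0
      assume L: "lie_deriv g h f = (\<lambda>x. - of_int k * f x)"
      have "f = (\<lambda>_. 0)"
      proof
        fix xs
        show "f xs = 0"
          using fun_cong[OF L, of "[]"] f k 0 by (cases xs) (auto simp: cochains_0_iff)
      qed
      then show ?thesis by (simp add: 0 coboundaries_0)
    next
      case (Suc m)
      assume L: "lie_deriv g h f = (\<lambda>x. - of_int k * f x)"
      have f': "f \<in> cochains g (Suc m)" using f Suc by simp
      have "contract h (ce_diff g (Suc m) f) = (\<lambda>_. 0)"
        using df Suc by (simp add: contract_def)
      then have eq: "ce_diff g m (contract h f) = (\<lambda>x. - of_int k * f x)"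
        unfolding contract_ce_diff[OF f' h] L by (auto simp: fun_eq_iff)
      \<comment> \<open>In Cartan's formula the term \<open>\<iota>\<^sub>h (d f)\<close> vanishes, so \<open>d (\<iota>\<^sub>h f) = -k f\<close>.\<close>
      have "f = ce_diff g m (\<lambda>x. (- 1 / of_int k) * contract h f x)"
        unfolding ce_diff_scale eq using k by auto
      moreover have "(\<lambda>x. (- 1 / of_int k) * contract h f x) \<in> cochains g m"
        by (rule fun_subspaceD(3)[OF cochains_subspace contract_cochain[OF f' h]])
      ultimately show ?thesis unfolding Suc coboundaries_Suc by (rule image_eqI)
    qed
  qed
qed

end

section \<open>The algebra sl(3) in characteristic three\<close>

text \<open>The basis consists of \<open>E\<^sub>1\<^sub>2, E\<^sub>2\<^sub>3, E\<^sub>1\<^sub>3, E\<^sub>2\<^sub>1, E\<^sub>3\<^sub>2, E\<^sub>3\<^sub>1\<close>, of \<open>h = E\<^sub>1\<^sub>1 - E\<^sub>2\<^sub>2\<close> and of the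
identity matrix, which is traceless and central in characteristic three; this choice makes most
structure constants vanish.\<close>

definition sl3_deg :: "nat \<Rightarrow> int" where
  "sl3_deg s = [1, 1, 2, -1, -1, -2, 0, 0] ! s"

definition sl3_entry :: "nat \<Rightarrow> nat \<Rightarrow> nat \<Rightarrow> int" where
  "sl3_entry s i j =
    [[[0,1,0],[0,0,0],[0,0,0]], [[0,0,0],[0,0,1],[0,0,0]], [[0,0,1],[0,0,0],[0,0,0]],
     [[0,0,0],[1,0,0],[0,0,0]], [[0,0,0],[0,0,0],[0,1,0]], [[0,0,0],[0,0,0],[1,0,0]],
     [[1,0,0],[0,-1,0],[0,0,0]], [[1,0,0],[0,1,0],[0,0,1]]] ! s ! i ! j"

text \<open>The structure constants are valid modulo \<open>3\<close> only; pairs \<open>s < t\<close> that are not listed commute.\<close>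

definition bracket_table :: "((nat \<times> nat) \<times> (int \<times> nat) list) list" where
  "bracket_table =
    [((0, 1), [(1, 2)]),
     ((0, 3), [(1, 6)]),
     ((0, 5), [(-1, 4)]),
     ((0, 6), [(1, 0)]),
     ((1, 4), [(1, 6), (-1, 7)]),
     ((1, 5), [(1, 3)]),
     ((1, 6), [(1, 1)]),
     ((2, 3), [(-1, 1)]),
     ((2, 4), [(1, 0)]),
     ((2, 5), [(-1, 6), (-1, 7)]),
     ((2, 6), [(-1, 2)]),
     ((3, 4), [(-1, 5)]),
     ((3, 6), [(-1, 3)]),
     ((4, 6), [(-1, 4)]),
     ((5, 6), [(1, 5)])]"

definition lookup :: "('b \<times> 'c list) list \<Rightarrow> 'b \<Rightarrow> 'c list" where
  "lookup t x = (case map_of t x of None \<Rightarrow> [] | Some c \<Rightarrow> c)"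

definition sl3_bracket :: "nat \<Rightarrow> nat \<Rightarrow> (int \<times> nat) list" where
  "sl3_bracket s t = (if s < t then lookup bracket_table (s, t)
     else map (\<lambda>(a, u). (- a, u)) (lookup bracket_table (t, s)))"

text \<open>The two tables result from Gaussian elimination over the field with three elements, with the order of
the monomials chosen so as to get few nonzero entries. Monomials that are not listed are mapped to
zero. The monomials have degree \<open>0\<close>, \<open>-3\<close> and \<open>3\<close>, in this order.\<close>

definition homotopy_table :: "(nat list \<times> chain) list" where
  "homotopy_table =
    [([6], [(-1, [0,3])]),
     ([7], [(1, [2,5]), (1, [0,3])]),
     ([1,4], [(1, [2,3,4])]),
     ([6,7], [(-1, [2,5,6])]),
     ([0,1,5], [(1, [2,3,4,6]), (1, [0,2,3,5]), (-1, [0,1,3,4])]),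
     ([0,3,7], [(-1, [2,3,4,6]), (1, [0,1,3,4]), (1, [0,2,3,5])]),
     ([0,4,7], [(-1, [0,2,4,5])]),
     ([1,3,7], [(-1, [1,2,3,5])]),
     ([1,4,6], [(1, [2,3,4,6])]),
     ([1,4,7], [(1, [2,3,4,6]), (-1, [0,2,3,5]), (1, [1,2,4,5]), (-1, [0,1,5,7])]),
     ([2,5,7], [(1, [0,1,5,7]), (1, [1,2,4,5]), (1, [0,1,3,4])]),
     ([0,1,5,6], [(1, [0,2,3,5,6]), (-1, [0,1,3,4,6])]),
     ([0,3,6,7], [(-1, [0,2,3,5,6]), (-1, [0,1,3,4,6])]),
     ([0,4,6,7], [(-1, [0,2,4,5,7])]),
     ([1,3,6,7], [(1, [1,2,3,5,6])]),
     ([1,4,6,7], [(-1, [1,2,4,5,6]), (1, [0,2,3,5,6]), (-1, [0,1,5,6,7])]),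
     ([2,3,4,7], [(-1, [0,1,3,4,6]), (-1, [0,1,3,4,7]), (-1, [1,2,4,5,6]), (-1, [0,1,5,6,7])]),
     ([2,5,6,7], [(1, [0,1,5,6,7]), (-1, [0,1,3,4,6]), (-1, [1,2,4,5,6])]),
     ([0,2,3,5,7], [(1, [0,1,2,3,4,5])]),
     ([1,2,4,5,7], [(-1, [0,1,2,3,4,5])]),
     ([2,3,4,6,7], [(1, [0,2,3,5,6,7])]),
     ([0,1,3,4,6,7], [(-1, [0,1,2,3,4,5,6])]),
     ([1,2,4,5,6,7], [(-1, [0,1,2,3,4,5,7]), (-1, [0,1,2,3,4,5,6])]),
     ([3,5,7], [(-1, [1,3,4,5])]),
     ([4,5,6], [(-1, [0,3,4,5])]),
     ([3,5,6,7], [(1, [1,3,4,5,7])]),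
     ([4,5,6,7], [(-1, [0,3,4,5,7])]),
     ([0,2,7], [(-1, [0,1,2,4])]),
     ([1,2,6], [(-1, [0,1,2,3])]),
     ([0,2,6,7], [(1, [0,1,2,4,7])]),
     ([1,2,6,7], [(-1, [0,1,2,3,7])])]"

text \<open>For each degree \<open>k\<close> and exterior power \<open>i\<close>, pairs of a cycle and a cocycle, dual to each other. The
cocycle is given by its values on monomials.\<close>

definition class_table :: "((int \<times> nat) \<times> (chain \<times> chain) list) list" where
  "class_table =
    [((0, 0), [([(1, [])], [(1, [])])]),
     ((0, 2), [([(1, [0,4])], [(1, [0,4])]),
        ([(1, [1,3])], [(1, [1,3])])]),
     ((0, 3), [([(1, [0,3,6])], [(1, [0,1,5]), (1, [0,3,6]), (1, [0,3,7]), (-1, [1,4,6]), (1, [1,4,7]), (-1, [2,5,7])]),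
        ([(1, [0,4,6])], [(1, [0,4,6]), (-1, [0,4,7])]),
        ([(1, [1,3,6])], [(1, [1,3,6]), (-1, [1,3,7])])]),
     ((0, 5), [([(1, [0,2,4,5,6]), (1, [0,2,4,5,7])], [(1, [0,2,4,5,6])]),
        ([(1, [1,2,3,5,7]), (1, [1,2,3,5,6])], [(1, [1,2,3,5,7])]),
        ([(1, [1,2,4,5,7]), (-1, [0,1,3,4,7]), (-1, [0,1,5,6,7]), (1, [0,2,3,5,7])], [(1, [1,2,4,5,7])])]),
     ((0, 6), [([(1, [0,2,4,5,6,7])], [(1, [0,2,4,5,6,7])]),
        ([(1, [1,2,3,5,6,7])], [(1, [1,2,3,5,6,7])])]),
     ((0, 8), [([(1, [0,1,2,3,4,5,6,7])], [(1, [0,1,2,3,4,5,6,7])])]),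
     ((3, 2), [([(1, [3,5])], [(1, [3,5])]),
        ([(1, [4,5])], [(1, [4,5])])]),
     ((3, 3), [([(1, [3,5,6])], [(1, [3,5,6]), (1, [3,5,7])]),
        ([(1, [4,5,7])], [(1, [4,5,7])])]),
     ((3, 5), [([(1, [0,3,4,5,6])], [(1, [0,3,4,5,6])]),
        ([(-1, [1,3,4,5,6]), (1, [1,3,4,5,7])], [(-1, [1,3,4,5,6])])]),
     ((3, 6), [([(1, [0,3,4,5,6,7])], [(1, [0,3,4,5,6,7])]),
        ([(1, [1,3,4,5,6,7])], [(1, [1,3,4,5,6,7])])]),
     ((-3, 2), [([(1, [0,2])], [(1, [0,2])]),
        ([(1, [1,2])], [(1, [1,2])])]),
     ((-3, 3), [([(1, [0,2,6])], [(1, [0,2,6]), (1, [0,2,7])]),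
        ([(1, [1,2,7])], [(1, [1,2,7])])]),
     ((-3, 5), [([(1, [0,1,2,3,6])], [(1, [0,1,2,3,6])]),
        ([(-1, [0,1,2,4,6]), (1, [0,1,2,4,7])], [(-1, [0,1,2,4,6])])]),
     ((-3, 6), [([(1, [0,1,2,3,6,7])], [(1, [0,1,2,3,6,7])]),
        ([(1, [0,1,2,4,6,7])], [(1, [0,1,2,4,6,7])])])]"

definition sl3_monomials :: "int \<Rightarrow> nat list list" where
  "sl3_monomials D = filter (\<lambda>S. sum_list (map sl3_deg S) = D) (subseqs [0..<8])"

definition is_chain :: "nat \<Rightarrow> int \<Rightarrow> chain \<Rightarrow> bool" where
  "is_chain i D c \<longleftrightarrow> (\<forall>(a, T)\<in>set c. sorted_wrt (<) T \<and> (\<forall>t\<in>set T. t < 8) \<and> length T = i \<and>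
     sum_list (map sl3_deg T) = D)"

definition homotopy_check :: "int \<Rightarrow> nat list \<Rightarrow> bool" where
  "homotopy_check k S \<longleftrightarrow>
    is_chain (Suc (length S)) (- k) (lookup homotopy_table S) \<and>
    vanishes 3 (chain_bind (boundary sl3_bracket S) (lookup homotopy_table) @
      chain_bind (lookup homotopy_table S) (boundary sl3_bracket) @
      concat (map (\<lambda>(\<phi>, z). chain_scale (coef z S) \<phi>) (lookup class_table (k, length S))) @ [(-1, S)])"

definition cocycle_check :: "int \<Rightarrow> nat list \<Rightarrow> bool" where
  "cocycle_check k S \<longleftrightarrow>
    (\<forall>(\<phi>, z)\<in>set (lookup class_table (k, length S - 1)). int_eval z (boundary sl3_bracket S) mod 3 = 0)"

definition class_check :: "(int \<times> nat) \<times> (chain \<times> chain) list \<Rightarrow> bool" where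
  "class_check = (\<lambda>((k, i), R).
    (\<forall>(\<phi>, z)\<in>set R. is_chain i (- k) \<phi> \<and> vanishes 3 (chain_bind \<phi> (boundary sl3_bracket))) \<and>
    (\<forall>j\<in>set [0..<length R]. \<forall>l\<in>set [0..<length R].
       (int_eval (snd (R ! l)) (fst (R ! j)) - (if j = l then 1 else 0)) mod 3 = 0))"

text \<open>Together with the next fact, the entire computation for the degrees \<open>0\<close> and \<open>\<plusminus>3\<close>.\<close>

lemma class_checks: "\<forall>r\<in>set class_table. class_check r"
  by code_simp

lemma monomials_checks:
  "\<forall>k\<in>set [0, 3, -3]. \<forall>S\<in>set (sl3_monomials (- k)). homotopy_check k S \<and> cocycle_check k S"
  by code_simp

lemma degree_bound: "\<forall>S\<in>set (subseqs [0..<8]). \<bar>sum_list (map sl3_deg S)\<bar> \<le> 4"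
  by code_simp

lemma bracket_checks:
  "\<forall>s\<in>set [0..<8]. \<forall>t\<in>set [0..<8].
     (\<forall>(a, u)\<in>set (sl3_bracket s t). u < 8 \<and> sl3_deg u = sl3_deg s + sl3_deg t) \<and>
     (\<forall>i\<in>set [0..<3]. \<forall>j\<in>set [0..<3].
       ((\<Sum>l\<leftarrow>[0..<3]. sl3_entry s i l * sl3_entry t l j - sl3_entry t i l * sl3_entry s l j) -
        (\<Sum>(a, u)\<leftarrow>sl3_bracket s t. a * sl3_entry u i j)) mod 3 = 0)"
  by code_simp

lemma matrix_comb_carrier: "(\<And>a s. (a, s) \<in> set L \<Longrightarrow> b s \<in> carrier_mat n n) \<Longrightarrow> matrix_comb n b L \<in> carrier_mat n n"
proof (induction L)
  case (Cons p L)
  obtain a s where p: "p = (a, s)" by force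
  have "matrix_comb n b L \<in> carrier_mat n n"
    by (rule Cons.IH) (use Cons.prems in auto)
  with Cons.prems[of a s] show ?case by (simp add: p matrix_comb_def)
qed (simp add: matrix_comb_def)

lemma matrix_comb_index:
  assumes "\<And>a s. (a, s) \<in> set L \<Longrightarrow> b s \<in> carrier_mat n n" and "i < n" "j < n"
  shows "matrix_comb n b L $$ (i, j) = (\<Sum>(a, s)\<leftarrow>L. a * b s $$ (i, j))"
  using assms(1)
proof (induction L)
  case Nil
  show ?case using assms(2,3) by (simp add: matrix_comb_def)
next
  case (Cons p L)
  obtain a s where p: "p = (a, s)" by force
  have s: "b s \<in> carrier_mat n n" using Cons.prems[of a s] p by simp
  have L: "matrix_comb n b L \<in> carrier_mat n n"
    by (rule matrix_comb_carrier) (use Cons.prems in auto)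
  have "matrix_comb n b (p # L) = a \<cdot>\<^sub>m b s + matrix_comb n b L"
    by (simp add: matrix_comb_def p)
  moreover have "matrix_comb n b L $$ (i, j) = (\<Sum>(a, s)\<leftarrow>L. a * b s $$ (i, j))"
    by (rule Cons.IH) (use Cons.prems in auto)
  ultimately show ?case using s L assms(2,3) by (simp add: p)
qed

definition sl3_basis :: "nat \<Rightarrow> 'a::field mat" where
  "sl3_basis s = mat 3 3 (\<lambda>(i, j). of_int (sl3_entry s i j))"

definition sl3_coord :: "nat \<Rightarrow> 'a::field mat \<Rightarrow> 'a" where
  "sl3_coord s x = [x $$ (0, 1), x $$ (1, 2), x $$ (0, 2), x $$ (1, 0), x $$ (2, 1), x $$ (2, 0),
     x $$ (0, 0) - x $$ (2, 2), x $$ (2, 2)] ! s"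

lemma sl3_basis_carrier [simp]: "sl3_basis s \<in> carrier_mat 3 3"
  by (simp add: sl3_basis_def)

lemma less_8: "(s::nat) < 8 \<longleftrightarrow> s \<in> {0, 1, 2, 3, 4, 5, 6, 7}"
  by auto

lemma less_3: "(i::nat) < 3 \<longleftrightarrow> i \<in> {0, 1, 2}"
  by auto

lemma lessThan_3: "{..<3::nat} = {0, 1, 2}"
  by auto

lemma sl_add: "x \<in> sl n \<Longrightarrow> y \<in> sl n \<Longrightarrow> x + y \<in> sl n"
  by (auto simp: sl_def sum.distrib)

lemma sl_smult: "x \<in> sl n \<Longrightarrow> c \<cdot>\<^sub>m x \<in> sl n"
  by (auto simp: sl_def sum_distrib_left[symmetric])

lemma of_int_3: "CHAR('a::field) = 3 \<Longrightarrow> of_int 3 = (0 :: 'a)"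
  by (simp add: of_int_eq_0_iff_char_dvd del: of_int_numeral)

lemma sl3_basis_graded:
  assumes p: "CHAR('a::field) = 3" and s: "s < 8"
  shows "(sl3_basis s :: 'a mat) \<in> principal_grading 3 (sl3_deg s)"
proof -
  have 3: "(3::'a) = 0" using of_int_3[OF p] by simp
  have "1 + (1 + 1) = (0::'a)" using 3 by simp
  then show ?thesis
    using s unfolding less_8 principal_grading_def sl_def
    by (auto simp: lessThan_3 less_3 sl3_basis_def sl3_entry_def sl3_deg_def)
qed

lemma of_int_comb:
  assumes "\<And>u. F u = (of_int (G u) :: 'a::comm_ring_1)"
  shows "(\<Sum>(a, u)\<leftarrow>L. of_int a * F u) = of_int (\<Sum>(a, u)\<leftarrow>L. a * G u)"
  by (induction L) (auto simp: assms)

text \<open>Traces and brackets come out right only modulo \<open>3\<close>: the identity matrix has trace \<open>3\<close>, and its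
coordinate \<open>x\<^sub>3\<^sub>3\<close> together with \<open>x\<^sub>1\<^sub>1 - x\<^sub>3\<^sub>3\<close> determines \<open>x\<^sub>2\<^sub>2 = 2 x\<^sub>3\<^sub>3 - x\<^sub>1\<^sub>1\<close> by the trace condition.\<close>

lemma sl3_graded_basis:
  assumes p: "CHAR('a::field) = 3"
  shows "graded_basis (sl 3 :: 'a mat set) 3 (principal_grading 3) sl3_basis sl3_coord 8
    sl3_deg sl3_bracket"
proof
  have p3: "of_int 3 = (0 :: 'a)" by (rule of_int_3[OF p])
  then have 3: "(3::'a) = 0" by simp
  fix x y :: "'a mat" and c :: 'a and s t :: nat and d :: int
  show "x \<in> sl 3 \<Longrightarrow> x \<in> carrier_mat 3 3" by (simp add: sl_def)
  show "x \<in> sl 3 \<Longrightarrow> y \<in> sl 3 \<Longrightarrow> x + y \<in> sl 3" by (rule sl_add)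
  show "x \<in> sl 3 \<Longrightarrow> c \<cdot>\<^sub>m x \<in> sl 3" by (rule sl_smult)
  show "x \<in> sl 3 \<Longrightarrow> y \<in> sl 3 \<Longrightarrow> lie_bracket x y \<in> sl 3" by (rule lie_bracket_in_sl)
  show "x \<in> principal_grading 3 d \<Longrightarrow> x \<in> sl 3" by (simp add: principal_grading_def)
  show "s < 8 \<Longrightarrow> (sl3_basis s :: 'a mat) \<in> principal_grading 3 (sl3_deg s)"
    by (rule sl3_basis_graded[OF p])
  { assume s: "s < 8"
    show "x \<in> sl 3 \<Longrightarrow> y \<in> sl 3 \<Longrightarrow> sl3_coord s (x + y) = sl3_coord s x + sl3_coord s y"
      using s unfolding less_8 by (auto simp: sl3_coord_def sl_def)
    show "x \<in> sl 3 \<Longrightarrow> sl3_coord s (c \<cdot>\<^sub>m x) = c * sl3_coord s x"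
      using s unfolding less_8 by (auto simp: sl3_coord_def sl_def algebra_simps)
    show "t < 8 \<Longrightarrow> sl3_coord s (sl3_basis t :: 'a mat) = (if s = t then 1 else 0)"
      using s unfolding less_8 by (auto simp: sl3_coord_def sl3_basis_def sl3_entry_def)
    assume t: "t < 8"
    have sub: "u < 8 \<and> sl3_deg u = sl3_deg s + sl3_deg t" if "(a, u) \<in> set (sl3_bracket s t)" for a u
      using bracket_checks s t that by fastforce
    then show "(a, u) \<in> set (sl3_bracket s t) \<Longrightarrow> u < 8 \<and> sl3_deg u = sl3_deg s + sl3_deg t" for a u .
    show "lie_bracket (sl3_basis s) (sl3_basis t :: 'a mat) =
        matrix_comb 3 sl3_basis (map (\<lambda>(a, u). (of_int a :: 'a, u)) (sl3_bracket s t))" (is "?L = ?R")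
    proof (rule eq_matI)
      have R: "?R \<in> carrier_mat 3 3" by (rule matrix_comb_carrier) simp
      then show "dim_row ?L = dim_row ?R" "dim_col ?L = dim_col ?R"
        by (simp_all add: lie_bracket_def sl3_basis_def)
      fix i j assume "i < dim_row ?R" "j < dim_col ?R"
      with R have ij: "i < 3" "j < 3" by auto
      let ?l = "\<Sum>l\<leftarrow>[0..<3]. sl3_entry s i l * sl3_entry t l j - sl3_entry t i l * sl3_entry s l j"
      let ?r = "\<Sum>(a, u)\<leftarrow>sl3_bracket s t. a * sl3_entry u i j"
      have "(?l - ?r) mod 3 = 0" using bracket_checks s t ij by simp
      then have "of_int (?l - ?r) = (0 :: 'a)" by (rule of_int_eq_0_mod[OF p3])
      moreover have "?L $$ (i, j) = of_int ?l"
        using ij by (simp add: lie_bracket_def sl3_basis_def scalar_prod_def upt_rec atLeast0LessThan lessThan_3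
            flip: numeral_2_eq_2)
      moreover have "?R $$ (i, j) = of_int ?r"
      proof -
        have "?R $$ (i, j) = (\<Sum>(a, u)\<leftarrow>sl3_bracket s t. of_int a * (sl3_basis u $$ (i, j) :: 'a))"
          by (subst matrix_comb_index) (use ij in \<open>simp_all add: comp_def case_prod_unfold\<close>)
        also have "\<dots> = of_int ?r"
          using ij by (intro of_int_comb) (simp_all add: sl3_basis_def)
        finally show ?thesis .
      qed
      ultimately show "?L $$ (i, j) = ?R $$ (i, j)" by simp
    qed
  }
  show "x = matrix_comb 3 sl3_basis (map (\<lambda>s. (sl3_coord s x, s)) [0..<8])" if x: "x \<in> sl 3"
  proof (rule eq_matI)
    let ?R = "matrix_comb 3 sl3_basis (map (\<lambda>s. (sl3_coord s x, s)) [0..<8])"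
    have R: "?R \<in> carrier_mat 3 3" by (rule matrix_comb_carrier) simp
    have X: "x \<in> carrier_mat 3 3" and tr: "x $$ (0, 0) + (x $$ (1, 1) + x $$ (2, 2)) = 0"
      using x by (simp_all add: sl_def lessThan_3)
    show "dim_row x = dim_row ?R" "dim_col x = dim_col ?R" using R X by auto
    fix i j assume "i < dim_row ?R" "j < dim_col ?R"
    with R have ij: "i < 3" "j < 3" by auto
    have "x $$ (1, 1) = 3 * x $$ (2, 2) - x $$ (0, 0) - x $$ (2, 2)"
      using tr unfolding 3 by (simp add: add_eq_0_iff algebra_simps)
    then have diag: "x $$ (1, 1) = x $$ (2, 2) - (x $$ (0, 0) - x $$ (2, 2))"
      by (simp add: algebra_simps)
    have "?R $$ (i, j) = (\<Sum>s\<leftarrow>[0..<8]. sl3_coord s x * sl3_basis s $$ (i, j))"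
      by (subst matrix_comb_index) (use ij in \<open>simp_all add: comp_def\<close>)
    also have "\<dots> = x $$ (i, j)"
      using ij unfolding less_3
      by (auto simp: upt_rec sl3_coord_def sl3_basis_def sl3_entry_def diag[simplified])
    finally show "x $$ (i, j) = ?R $$ (i, j)" ..
  qed
  show "sl3_deg s = d" if "x \<in> principal_grading 3 d" "s < 8" "sl3_coord s x \<noteq> 0"
  proof -
    have *: "x $$ (i, j) \<noteq> 0 \<Longrightarrow> int j - int i = d" if "i < 3" "j < 3" for i j
      using \<open>x \<in> principal_grading 3 d\<close> that by (auto simp: principal_grading_def)
    have "d = 0" if "x $$ (0, 0) \<noteq> x $$ (2, 2)"
      using that *[of 0 0] *[of 2 2] by (cases "x $$ (0, 0) = 0") auto
    then show ?thesis
      using that(2,3) *[of 0 1] *[of 1 2] *[of 0 2] *[of 1 0] *[of 2 1] *[of 2 0] *[of 2 2]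
      unfolding less_8 by (auto simp: sl3_coord_def sl3_deg_def)
  qed
qed

lemma sl3_monomialsI: "S \<in> monomials 8 sl3_deg i D \<Longrightarrow> S \<in> set (sl3_monomials D) \<and> length S = i"
  using monomials_subseqs[of S 8 sl3_deg i D] by (auto simp: sl3_monomials_def monomials_def)

lemma is_chain_iff: "is_chain i D c \<longleftrightarrow> c \<in> chain_space 8 sl3_deg i D"
  by (auto simp: is_chain_def chain_space_def monomials_def subset_iff)

lemma sl3_cohomology:
  assumes p: "CHAR('a::field) = 3" and k: "k \<in> {0, 3, -3}"
  defines "R i \<equiv> lookup class_table (k, i)"
  defines "H i \<equiv> graded_cohomology (sl 3 :: 'a mat set) (principal_grading 3) i k"
  shows "has_dim (H i) (length (R i))"
    and "R i = [] \<Longrightarrow> carrier (H i) = {\<zero>\<^bsub>H i\<^esub>}"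
proof -
  interpret graded_basis "sl 3 :: 'a mat set" 3 "principal_grading 3" sl3_basis sl3_coord 8
    sl3_deg sl3_bracket
    by (rule sl3_graded_basis[OF p])
  have mono: "homotopy_check k S \<and> cocycle_check k S \<and> length S = j"
    if "S \<in> monomials 8 sl3_deg j (- k)" for S j
    using monomials_checks k sl3_monomialsI[OF that] by auto
  have entry: "class_check ((k, i), R i)"
  proof (cases "map_of class_table (k, i)")
    case None
    then show ?thesis by (simp add: R_def lookup_def class_check_def)
  next
    case (Some c)
    then show ?thesis using class_checks map_of_SomeD[OF Some] by (auto simp: R_def lookup_def)
  qed
  have 1: "lookup homotopy_table S \<in> chain_space 8 sl3_deg (Suc i) (- k)"
    if "S \<in> monomials 8 sl3_deg i (- k)" for S
    using mono[OF that] by (auto simp: homotopy_check_def is_chain_iff)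
  have 2: "\<phi> \<in> chain_space 8 sl3_deg i (- k) \<and> vanishes 3 (chain_bind \<phi> (boundary sl3_bracket))"
    if "(\<phi>, z) \<in> set (R i)" for \<phi> z
    using entry that unfolding class_check_def is_chain_iff by blast
  have 3: "int_eval z (boundary sl3_bracket S) mod 3 = 0"
    if "S \<in> monomials 8 sl3_deg (Suc i) (- k)" "(\<phi>, z) \<in> set (R i)" for S \<phi> z
    using mono[OF that(1)] that(2) unfolding cocycle_check_def R_def by auto
  have 4: "(int_eval (snd (R i ! l)) (fst (R i ! j)) - (if j = l then 1 else 0)) mod 3 = 0"
    if "j < length (R i)" "l < length (R i)" for j l
    using entry that unfolding class_check_def by simp
  have 5: "vanishes 3 (chain_bind (boundary sl3_bracket S) (lookup homotopy_table) @
      chain_bind (lookup homotopy_table S) (boundary sl3_bracket) @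
      concat (map (\<lambda>(\<phi>, z). chain_scale (coef z S) \<phi>) (R i)) @ [(- 1, S)])"
    if "S \<in> monomials 8 sl3_deg i (- k)" for S
    using mono[OF that] unfolding homotopy_check_def R_def by auto
  note hyps = of_int_3[OF p] 1 2 3 4 5
  show "has_dim (H i) (length (R i))"
    unfolding H_def by (rule has_dim_by_homotopy[OF hyps])
  show "carrier (H i) = {\<zero>\<^bsub>H i\<^esub>}" if "R i = []"
    unfolding H_def by (rule trivial_by_homotopy[OF hyps that])
qed

lemma sl3_cohomology_trivial:
  assumes p: "CHAR('a::field) = 3" and k: "k \<notin> {0, 3, -3}"
  defines "H i \<equiv> graded_cohomology (sl 3 :: 'a mat set) (principal_grading 3) i k"
  shows "carrier (H i) = {\<zero>\<^bsub>H i\<^esub>}"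
proof -
  interpret graded_basis "sl 3 :: 'a mat set" 3 "principal_grading 3" sl3_basis sl3_coord 8
    sl3_deg sl3_bracket
    by (rule sl3_graded_basis[OF p])
  have p3: "of_int 3 = (0 :: 'a)" by (rule of_int_3[OF p])
  show ?thesis
  proof (cases "3 dvd k")
    case False
    show ?thesis
      unfolding H_def
    proof (rule trivial_by_weight)
      show "(sl3_basis 6 :: 'a mat) \<in> sl 3" by (rule basis_in) simp
      show "of_int k \<noteq> (0 :: 'a)"
        using False p by (simp add: of_int_eq_0_iff_char_dvd)
      fix s :: nat assume s: "s < 8"
      have "(3::'a) = 0" using p3 by simp
      \<comment> \<open>The eigenvalues of the bracket with \<open>h\<close> are minus the degrees only modulo \<open>3\<close>: for \<open>E\<^sub>1\<^sub>3\<close> it is \<open>1 = -2\<close>.\<close>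
      then have two: "(2::'a) = - 1" by (simp add: eq_neg_iff_add_eq_0)
      show "lie_bracket (sl3_basis 6) (sl3_basis s) = of_int (- sl3_deg s) \<cdot>\<^sub>m (sl3_basis s :: 'a mat)"
        unfolding bracket_basis[OF _ s, of 6, simplified]
        using s unfolding less_8
        by (auto simp: matrix_comb_def sl3_bracket_def lookup_def bracket_table_def sl3_deg_def two
            right_add_zero_mat[of _ 3 3])
          (auto intro!: eq_matI simp: sl3_basis_def)
    qed
  next
    case True
    with k have "\<bar>k\<bar> > 4" by (auto simp: dvd_def)
    have empty: "S \<notin> monomials 8 sl3_deg i (- k)" for S
    proof
      assume "S \<in> monomials 8 sl3_deg i (- k)"
      then have "S \<in> set (subseqs [0..<8])" "sum_list (map sl3_deg S) = - k"
        using sl3_monomialsI by (auto simp: sl3_monomials_def)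
      with degree_bound \<open>\<bar>k\<bar> > 4\<close> show False by force
    qed
    show ?thesis
      unfolding H_def
      by (rule trivial_by_homotopy[OF p3, where H = "\<lambda>_. []" and R = "[]"]) (simp_all add: empty)
  qed
qed

theorem mainTheorem6:
  fixes H :: "nat \<Rightarrow> int \<Rightarrow> ('a::alg_closed_field, ('a mat list \<Rightarrow> 'a) set) module"
  assumes char3: "CHAR('a) = 3"
    and H: "H = graded_cohomology (sl 3) (principal_grading 3)"
  shows
    "(has_dim (H 0 0) 1 \<and> has_dim (H 2 0) 2 \<and> has_dim (H 3 0) 3 \<and>
      has_dim (H 5 0) 3 \<and> has_dim (H 6 0) 2 \<and> has_dim (H 8 0) 1 \<and>
      (\<forall>i. i \<notin> {0, 2, 3, 5, 6, 8} \<longrightarrow> carrier (H i 0) = {\<zero>\<^bsub>H i 0\<^esub>})) \<and>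
     (\<forall>k\<in>{3, -3}.
      has_dim (H 2 k) 2 \<and> has_dim (H 3 k) 2 \<and> has_dim (H 5 k) 2 \<and> has_dim (H 6 k) 2 \<and>
      (\<forall>i. i \<notin> {2, 3, 5, 6} \<longrightarrow> carrier (H i k) = {\<zero>\<^bsub>H i k\<^esub>})) \<and>
     (\<forall>k. k \<notin> {0, 3, -3} \<longrightarrow> (\<forall>i. carrier (H i k) = {\<zero>\<^bsub>H i k\<^esub>}))"
proof -
  have dim: "has_dim (H i k) (length (lookup class_table (k, i)))"
    and triv: "lookup class_table (k, i) = [] \<Longrightarrow> carrier (H i k) = {\<zero>\<^bsub>H i k\<^esub>}"
    if "k \<in> {0, 3, -3}" for i k
    unfolding H by (rule sl3_cohomology[OF char3 that])+
  show ?thesis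
  proof (intro conjI ballI allI impI)
    show "has_dim (H 0 0) 1" "has_dim (H 2 0) 2" "has_dim (H 3 0) 3"
      "has_dim (H 5 0) 3" "has_dim (H 6 0) 2" "has_dim (H 8 0) 1"
      using dim[of 0 0] dim[of 0 2] dim[of 0 3] dim[of 0 5] dim[of 0 6] dim[of 0 8]
      by (simp_all add: lookup_def class_table_def numeral_2_eq_2 numeral_3_eq_3)
    show "carrier (H i 0) = {\<zero>\<^bsub>H i 0\<^esub>}" if "i \<notin> {0, 2, 3, 5, 6, 8}" for i
      by (rule triv) (use that in \<open>auto simp: lookup_def class_table_def\<close>)
  next
    fix k :: int assume k: "k \<in> {3, -3}"
    then show "has_dim (H 2 k) 2" "has_dim (H 3 k) 2" "has_dim (H 5 k) 2" "has_dim (H 6 k) 2"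
      using dim[of k 2] dim[of k 3] dim[of k 5] dim[of k 6]
      by (auto simp: lookup_def class_table_def numeral_2_eq_2)
    show "carrier (H i k) = {\<zero>\<^bsub>H i k\<^esub>}" if "i \<notin> {2, 3, 5, 6}" for i
      by (rule triv) (use k that in \<open>auto simp: lookup_def class_table_def\<close>)
  next
    show "carrier (H i k) = {\<zero>\<^bsub>H i k\<^esub>}" if "k \<notin> {0, 3, -3}" for i k
      unfolding H by (rule sl3_cohomology_trivial[OF char3 that])
  qed
qed

end
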